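(* Let $\{f_n\}$ be a quasi basis of $\mathfrak{H}$ and let $\mathcal{C}_0$ be the operator associated with the dual definite subspaces generated by $\{f_n\}$. Let $\mathcal{C}=Je^Q\supset\mathcal{C}_0$ be an operator of $\mathcal{C}$-symmetry such that $\{f_n\}$ is an orthonormal basis of the Hilbert space $(\mathfrak{H}_G,(\cdot,\cdot)_G)$ generated by $\mathcal{C}$ and $\{e^{Q/2}f_n\}$ is an orthonormal basis of $\mathfrak{H}$, each element of which belongs to $\mathfrak{H}_+$ or $\mathfrak{H}_-$. Then $$\mathcal{C}f=\sum_{n=1}^\infty[f,f_n]f_n,\qquad \mathcal{C}f=\sum_{n=1}^\infty[e^{Q/2}f,f_n]e^{Q/2}f_n,\qquad\forall f\in D(\mathcal{C}),$$ where the series are convergent in $\mathfrak{H}_G$ and $\mathfrak{H}$, respectively.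
   Context: $\mathfrak{H}$ is a complex Hilbert space with inner product $(\cdot,\cdot)$ (linear in the first argument), $J$ is a bounded operator with $J=J^*$, $J^2=I$, $J\neq\pm I$, $[f,g]=(Jf,g)$, and $\mathfrak{H}_\pm=\frac12(I\pm J)\mathfrak{H}$. Subspaces are closed. A subspace is positive (negative) if $[f,f]>0$ ($<0$) for all its nonzero $f$, and maximal positive (negative) if it is not a proper subspace of another positive (negative) subspace. Dual definite subspaces $\mathfrak{L}_\pm$: $\mathfrak{L}_+$ positive, $\mathfrak{L}_-$ negative, $[f_+,f_-]=0$ for all $f_\pm\in\mathfrak{L}_\pm$; dual maximal definite if moreover $\mathfrak{L}_+$ is maximal positive and $\mathfrak{L}_-$ is maximal negative. A sequence $\{f_n\}$ is $J$-orthonormal if $|[f_n,f_m]|=\delta_{nm}$; it is complete if its linear span is dense in $\mathfrak{H}$. The subspaces $\mathfrak{L}_+$ and $\mathfrak{L}_-$ generated by a complete $J$-orthonormal $\{f_n\}$ are the closures in $\mathfrak{H}$ of the spans of $\{f_n:[f_n,f_n]=1\}$ and $\{f_n:[f_n,f_n]=-1\}$ respectively; they are dual definite and $\mathfrak{L}_++\mathfrak{L}_-$ is dense in $\mathfrak{H}$. The operator $\mathcal{C}_0$ associated with dual definite $\mathfrak{L}_\pm$ with dense sum has domain $\mathfrak{L}_++\mathfrak{L}_-$ and $\mathcal{C}_0(f_++f_-)=f_+-f_-$, $f_\pm\in\mathfrak{L}_\pm$. It is called an operator of $\mathcal{C}$-symmetry, and denoted $\mathcal{C}$, if the subspaces are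 dual maximal definite. Equivalently, $\mathcal{C}=Je^Q$ with $Q$ self-adjoint and $JQ=-QJ$. Put $G_0=J\mathcal{C}_0$. For $\mathcal{C}=Je^Q$ put $G=J\mathcal{C}=e^Q$; the Hilbert space $(\mathfrak{H}_G,(\cdot,\cdot)_G)$ generated by $\mathcal{C}$ is the completion of $D(G)=D(\mathcal{C})$ with respect to $(f,g)_G=(Gf,g)$. Dual definite $\mathfrak{L}_\pm$ with dense sum are quasi maximal if there exists a positive self-adjoint extension $G\supset G_0$ with $JGf=G^{-1}Jf$ for all $f\in D(G)$ (equivalently, $G=J\mathcal{C}$ for an operator of $\mathcal{C}$-symmetry $\mathcal{C}\supset\mathcal{C}_0$) such that $D(G_0)=\mathfrak{L}_++\mathfrak{L}_-$ is dense in $(\mathfrak{H}_G,(\cdot,\cdot)_G)$. A complete $J$-orthonormal sequence is a quasi basis of $\mathfrak{H}$ if the subspaces $\mathfrak{L}_\pm$ it generates are quasi maximal. *)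

theory Defs
  imports "HOL-Analysis.Analysis"
begin

section \<open>Complex Hilbert spaces\<close>

class complex_hilbert_space = banach +
  fixes scaleC :: "complex \<Rightarrow> 'a \<Rightarrow> 'a"  (infixr \<open>*\<^sub>C\<close> 75)
    and cinner :: "'a \<Rightarrow> 'a \<Rightarrow> complex"
  assumes scaleC_add_right: "a *\<^sub>C (x + y) = a *\<^sub>C x + a *\<^sub>C y"
    and scaleC_add_left: "(a + b) *\<^sub>C x = a *\<^sub>C x + b *\<^sub>C x"
    and scaleC_scaleC: "a *\<^sub>C (b *\<^sub>C x) = (a * b) *\<^sub>C x"
    and scaleR_scaleC: "scaleR r x = complex_of_real r *\<^sub>C x"
    and cinner_commute: "cinner x y = cnj (cinner y x)"
    and cinner_add_left: "cinner (x + y) z = cinner x z + cinner y z"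
    and cinner_scaleC_left: "cinner (a *\<^sub>C x) y = a * cinner x y"
    and norm_eq_sqrt_cinner: "norm x = sqrt (Re (cinner x x))"

lemma scaleC_one: "1 *\<^sub>C x = (x :: 'a::complex_hilbert_space)"
  using scaleR_scaleC[of 1 x] by simp

global_interpretation complex_vector:
  vector_space "scaleC :: complex \<Rightarrow> 'a \<Rightarrow> 'a::complex_hilbert_space"
  by unfold_locales (simp_all add: scaleC_add_right scaleC_add_left scaleC_scaleC scaleC_one)

definition orthonormal_basis :: "(nat \<Rightarrow> 'a::complex_hilbert_space) \<Rightarrow> bool" where
  "orthonormal_basis e \<longleftrightarrow>
     (\<forall>n m. cinner (e n) (e m) = (if n = m then 1 else 0)) \<and>
     closure (complex_vector.span (range e)) = UNIV"


section \<open>Unbounded operators\<close>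

text \<open>An operator is a partial function; its domain is \<^const>\<open>dom\<close>, and \<open>A \<subseteq>\<^sub>m B\<close> says that
  \<open>B\<close> extends \<open>A\<close>.\<close>

type_synonym 'a operator = "'a \<rightharpoonup> 'a"

definition app :: "'a operator \<Rightarrow> 'a \<Rightarrow> 'a"  (infixl \<open>\<cdot>\<close> 90) where
  "A \<cdot> x = the (A x)"

definition linear_operator :: "'a::complex_hilbert_space operator \<Rightarrow> bool" where
  "linear_operator A \<longleftrightarrow>
     complex_vector.subspace (dom A) \<and>
     (\<forall>x\<in>dom A. \<forall>y\<in>dom A. A \<cdot> (x + y) = A \<cdot> x + A \<cdot> y) \<and>
     (\<forall>c. \<forall>x\<in>dom A. A \<cdot> (c *\<^sub>C x) = c *\<^sub>C (A \<cdot> x))"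

definition adjoint_operator :: "'a::complex_hilbert_space operator \<Rightarrow> 'a operator" where
  "adjoint_operator A = (\<lambda>y.
     if \<exists>z. \<forall>x\<in>dom A. cinner (A \<cdot> x) y = cinner x z
     then Some (THE z. \<forall>x\<in>dom A. cinner (A \<cdot> x) y = cinner x z) else None)"

definition selfadjoint :: "'a::complex_hilbert_space operator \<Rightarrow> bool" where
  "selfadjoint A \<longleftrightarrow>
     linear_operator A \<and> closure (dom A) = UNIV \<and> adjoint_operator A = A"

text \<open>For a self-adjoint operator the form is real, so taking the real part loses nothing.\<close>

definition positive_operator :: "'a::complex_hilbert_space operator \<Rightarrow> bool" where
  "positive_operator A \<longleftrightarrow> (\<forall>x\<in>dom A. x \<noteq> 0 \<longrightarrow> Re (cinner (A \<cdot> x) x) > 0)"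

text \<open>The product \<open>J A\<close> with an everywhere defined \<open>J\<close>, and the product \<open>A J\<close>, each with its
  natural domain.\<close>

definition lmult :: "('a \<Rightarrow> 'a) \<Rightarrow> 'a operator \<Rightarrow> 'a operator" where
  "lmult J A = (\<lambda>x. map_option J (A x))"

definition rmult :: "'a operator \<Rightarrow> ('a \<Rightarrow> 'a) \<Rightarrow> 'a operator" where
  "rmult A J = (\<lambda>x. A (J x))"


section \<open>Functional calculus of a self-adjoint operator\<close>

definition orthogonal_projection :: "('a::complex_hilbert_space \<Rightarrow> 'a) \<Rightarrow> bool" where
  "orthogonal_projection P \<longleftrightarrow>
     bounded_linear P \<and> (\<forall>c x. P (c *\<^sub>C x) = c *\<^sub>C P x) \<and>
     (\<forall>x. P (P x) = P x) \<and> (\<forall>x y. cinner (P x) y = cinner x (P y))"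

definition spectral_measure :: "(real set \<Rightarrow> 'a::complex_hilbert_space \<Rightarrow> 'a) \<Rightarrow> bool" where
  "spectral_measure E \<longleftrightarrow>
     (\<forall>B\<in>sets borel. orthogonal_projection (E B)) \<and>
     (\<forall>x. E {} x = 0) \<and> (\<forall>x. E UNIV x = x) \<and>
     (\<forall>A\<in>sets borel. \<forall>B\<in>sets borel. \<forall>x. E (A \<inter> B) x = E A (E B x)) \<and>
     (\<forall>A :: nat \<Rightarrow> real set. range A \<subseteq> sets borel \<longrightarrow> disjoint_family A \<longrightarrow>
        (\<forall>x. (\<lambda>n. E (A n) x) sums E (\<Union>n. A n) x))"

text \<open>The scalar measure \<open>B \<mapsto> (E(B)x, x)\<close>.\<close>

definition scalar_measure ::
    "(real set \<Rightarrow> 'a::complex_hilbert_space \<Rightarrow> 'a) \<Rightarrow> 'a \<Rightarrow> real measure" where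
  "scalar_measure E x =
     measure_of UNIV (sets borel) (\<lambda>B. ennreal (Re (cinner (E B x) x)))"

definition simple_integral ::
    "(real set \<Rightarrow> 'a::complex_hilbert_space \<Rightarrow> 'a) \<Rightarrow> (real \<Rightarrow> real) \<Rightarrow> 'a \<Rightarrow> 'a" where
  "simple_integral E s x = (\<Sum>c\<in>range s. scaleR c (E (s -` {c}) x))"

text \<open>The operator \<open>\<integral> \<phi> dE\<close> for a real Borel function \<open>\<phi>\<close>: its domain consists of the \<open>x\<close> with
  \<open>\<phi> \<in> L\<^sup>2(d(Ex,x))\<close>, and its value at \<open>x\<close> is the limit of the integrals of simple functions
  converging to \<open>\<phi>\<close> in \<open>L\<^sup>2(d(Ex,x))\<close>.\<close>

definition spectral_integral ::
    "(real set \<Rightarrow> 'a::complex_hilbert_space \<Rightarrow> 'a) \<Rightarrow> (real \<Rightarrow> real) \<Rightarrow> 'a operator" where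
  "spectral_integral E \<phi> = (\<lambda>x.
     if (\<integral>\<^sup>+ t. ennreal ((\<phi> t)\<^sup>2) \<partial>scalar_measure E x) < \<infinity>
     then Some (THE z. \<exists>s. (\<forall>n. simple_function borel (s n)) \<and>
            (\<lambda>n. \<integral>\<^sup>+ t. ennreal ((s n t - \<phi> t)\<^sup>2) \<partial>scalar_measure E x) \<longlonglongrightarrow> 0 \<and>
            (\<lambda>n. simple_integral E (s n) x) \<longlonglongrightarrow> z)
     else None)"

definition spectral_resolution ::
    "(real set \<Rightarrow> 'a::complex_hilbert_space \<Rightarrow> 'a) \<Rightarrow> 'a operator \<Rightarrow> bool" where
  "spectral_resolution E Q \<longleftrightarrow> spectral_measure E \<and> spectral_integral E (\<lambda>t. t) = Q"

text \<open>\<open>\<phi>(Q) = \<integral> \<phi> dE\<close>, where \<open>E\<close> is the spectral measure of \<open>Q\<close>. By the spectral theorem \<open>E\<close>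
  exists and is unique on Borel sets when \<open>Q\<close> is self-adjoint, so then \<open>\<phi>(Q)\<close> does not depend on
  the choice and the second branch does not occur.\<close>

definition fun_calc :: "(real \<Rightarrow> real) \<Rightarrow> 'a::complex_hilbert_space operator \<Rightarrow> 'a operator" where
  "fun_calc \<phi> Q =
     (if \<exists>E. spectral_resolution E Q
      then spectral_integral (SOME E. spectral_resolution E Q) \<phi>
      else Map.empty)"


section \<open>Completion of a complex inner product space\<close>

text \<open>The completion depends on a subspace and a form and not only on a type, so complex inner
  product spaces with an explicit carrier are needed.\<close>

record 'b cip_space =
  Carrier :: "'b set"
  Zero :: 'b
  Add :: "'b \<Rightarrow> 'b \<Rightarrow> 'b"
  Scale :: "complex \<Rightarrow> 'b \<Rightarrow> 'b"
  Inner :: "'b \<Rightarrow> 'b \<Rightarrow> complex"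

definition Dist :: "'b cip_space \<Rightarrow> 'b \<Rightarrow> 'b \<Rightarrow> real" where
  "Dist K x y = (let d = Add K x (Scale K (-1) y) in sqrt (Re (Inner K d d)))"

primrec Psum :: "'b cip_space \<Rightarrow> (nat \<Rightarrow> 'b) \<Rightarrow> nat \<Rightarrow> 'b" where
  "Psum K u 0 = Zero K"
| "Psum K u (Suc n) = Add K (Psum K u n) (u n)"

definition Sums :: "'b cip_space \<Rightarrow> (nat \<Rightarrow> 'b) \<Rightarrow> 'b \<Rightarrow> bool" where
  "Sums K u x \<longleftrightarrow> (\<lambda>N. Dist K (Psum K u N) x) \<longlonglongrightarrow> 0"

definition Dense :: "'b cip_space \<Rightarrow> 'b set \<Rightarrow> bool" where
  "Dense K S \<longleftrightarrow> S \<subseteq> Carrier K \<and> (\<forall>x\<in>Carrier K. \<forall>\<epsilon>>0. \<exists>y\<in>S. Dist K y x < \<epsilon>)"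

definition Orthonormal_Basis :: "'b cip_space \<Rightarrow> (nat \<Rightarrow> 'b) \<Rightarrow> bool" where
  "Orthonormal_Basis K e \<longleftrightarrow>
     range e \<subseteq> Carrier K \<and>
     (\<forall>n m. Inner K (e n) (e m) = (if n = m then 1 else 0)) \<and>
     Dense K {Psum K (\<lambda>n. Scale K (c n) (e n)) N | c N. True}"

definition form_norm :: "('a \<Rightarrow> 'a \<Rightarrow> complex) \<Rightarrow> 'a \<Rightarrow> real" where
  "form_norm B x = sqrt (Re (B x x))"

definition form_Cauchy ::
    "'a::complex_hilbert_space set \<Rightarrow> ('a \<Rightarrow> 'a \<Rightarrow> complex) \<Rightarrow> (nat \<Rightarrow> 'a) set" where
  "form_Cauchy D B =
     {u. range u \<subseteq> D \<and> (\<forall>\<epsilon>>0. \<exists>N. \<forall>m\<ge>N. \<forall>n\<ge>N. form_norm B (u m - u n) < \<epsilon>)}"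

definition form_rel ::
    "'a::complex_hilbert_space set \<Rightarrow> ('a \<Rightarrow> 'a \<Rightarrow> complex) \<Rightarrow> ((nat \<Rightarrow> 'a) \<times> (nat \<Rightarrow> 'a)) set" where
  "form_rel D B =
     {(u, v). u \<in> form_Cauchy D B \<and> v \<in> form_Cauchy D B \<and>
        (\<lambda>n. form_norm B (u n - v n)) \<longlonglongrightarrow> 0}"

definition form_class ::
    "'a::complex_hilbert_space set \<Rightarrow> ('a \<Rightarrow> 'a \<Rightarrow> complex) \<Rightarrow> (nat \<Rightarrow> 'a) \<Rightarrow> (nat \<Rightarrow> 'a) set" where
  "form_class D B u = form_rel D B `` {u}"

definition representative :: "(nat \<Rightarrow> 'a) set \<Rightarrow> nat \<Rightarrow> 'a" where
  "representative X = (SOME u. u \<in> X)"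

text \<open>The completion of the subspace \<open>D\<close> with respect to the inner product \<open>B\<close>: Cauchy sequences
  in \<open>D\<close> modulo null sequences.\<close>

definition completion ::
    "'a::complex_hilbert_space set \<Rightarrow> ('a \<Rightarrow> 'a \<Rightarrow> complex) \<Rightarrow> (nat \<Rightarrow> 'a) set cip_space" where
  "completion D B = \<lparr>
     Carrier = form_Cauchy D B // form_rel D B,
     Zero = form_class D B (\<lambda>_. 0),
     Add = (\<lambda>X Y. form_class D B (\<lambda>n. representative X n + representative Y n)),
     Scale = (\<lambda>c X. form_class D B (\<lambda>n. c *\<^sub>C representative X n)),
     Inner = (\<lambda>X Y. lim (\<lambda>n. B (representative X n) (representative Y n)))\<rparr>"

definition G_form :: "'a::complex_hilbert_space operator \<Rightarrow> 'a \<Rightarrow> 'a \<Rightarrow> complex" where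
  "G_form G x y = cinner (G \<cdot> x) y"

text \<open>The Hilbert space \<open>H\<^sub>G\<close> and the canonical embedding of \<open>D(G)\<close> into it.\<close>

definition H_G :: "'a::complex_hilbert_space operator \<Rightarrow> (nat \<Rightarrow> 'a) set cip_space" where
  "H_G G = completion (dom G) (G_form G)"

definition H_G_embed :: "'a::complex_hilbert_space operator \<Rightarrow> 'a \<Rightarrow> (nat \<Rightarrow> 'a) set" where
  "H_G_embed G x = form_class (dom G) (G_form G) (\<lambda>_. x)"


section \<open>Krein spaces and dual definite subspaces\<close>

definition fundamental_symmetry :: "('a::complex_hilbert_space \<Rightarrow> 'a) \<Rightarrow> bool" where
  "fundamental_symmetry J \<longleftrightarrow>
     bounded_linear J \<and> (\<forall>c x. J (c *\<^sub>C x) = c *\<^sub>C J x) \<and>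
     (\<forall>x y. cinner (J x) y = cinner x (J y)) \<and> (\<forall>x. J (J x) = x) \<and>
     J \<noteq> (\<lambda>x. x) \<and> J \<noteq> (\<lambda>x. - x)"

definition indef :: "('a::complex_hilbert_space \<Rightarrow> 'a) \<Rightarrow> 'a \<Rightarrow> 'a \<Rightarrow> complex" where
  "indef J x y = cinner (J x) y"

definition H_plus :: "('a::complex_hilbert_space \<Rightarrow> 'a) \<Rightarrow> 'a set" where
  "H_plus J = range (\<lambda>x. (1/2) *\<^sub>C (x + J x))"

definition H_minus :: "('a::complex_hilbert_space \<Rightarrow> 'a) \<Rightarrow> 'a set" where
  "H_minus J = range (\<lambda>x. (1/2) *\<^sub>C (x - J x))"

definition closed_subspace :: "'a::complex_hilbert_space set \<Rightarrow> bool" where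
  "closed_subspace L \<longleftrightarrow> complex_vector.subspace L \<and> closed L"

text \<open>The number \<open>[x, x]\<close> is real because \<open>J\<close> is self-adjoint.\<close>

definition positive_subspace :: "('a::complex_hilbert_space \<Rightarrow> 'a) \<Rightarrow> 'a set \<Rightarrow> bool" where
  "positive_subspace J L \<longleftrightarrow>
     closed_subspace L \<and> (\<forall>x\<in>L. x \<noteq> 0 \<longrightarrow> Re (indef J x x) > 0)"

definition negative_subspace :: "('a::complex_hilbert_space \<Rightarrow> 'a) \<Rightarrow> 'a set \<Rightarrow> bool" where
  "negative_subspace J L \<longleftrightarrow>
     closed_subspace L \<and> (\<forall>x\<in>L. x \<noteq> 0 \<longrightarrow> Re (indef J x x) < 0)"

definition maximal_positive :: "('a::complex_hilbert_space \<Rightarrow> 'a) \<Rightarrow> 'a set \<Rightarrow> bool" where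
  "maximal_positive J L \<longleftrightarrow>
     positive_subspace J L \<and> \<not> (\<exists>M. positive_subspace J M \<and> L \<subset> M)"

definition maximal_negative :: "('a::complex_hilbert_space \<Rightarrow> 'a) \<Rightarrow> 'a set \<Rightarrow> bool" where
  "maximal_negative J L \<longleftrightarrow>
     negative_subspace J L \<and> \<not> (\<exists>M. negative_subspace J M \<and> L \<subset> M)"

definition dual_definite ::
    "('a::complex_hilbert_space \<Rightarrow> 'a) \<Rightarrow> 'a set \<Rightarrow> 'a set \<Rightarrow> bool" where
  "dual_definite J Lp Lm \<longleftrightarrow>
     positive_subspace J Lp \<and> negative_subspace J Lm \<and>
     (\<forall>x\<in>Lp. \<forall>y\<in>Lm. indef J x y = 0)"

definition dual_maximal_definite ::
    "('a::complex_hilbert_space \<Rightarrow> 'a) \<Rightarrow> 'a set \<Rightarrow> 'a set \<Rightarrow> bool" where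
  "dual_maximal_definite J Lp Lm \<longleftrightarrow>
     dual_definite J Lp Lm \<and> maximal_positive J Lp \<and> maximal_negative J Lm"

definition subspace_sum :: "'a::complex_hilbert_space set \<Rightarrow> 'a set \<Rightarrow> 'a set" where
  "subspace_sum Lp Lm = {x + y | x y. x \<in> Lp \<and> y \<in> Lm}"

text \<open>The operator \<open>x + y \<mapsto> x - y\<close> on \<open>Lp + Lm\<close>; the decomposition is unique when the subspaces
  are dual definite.\<close>

definition C_zero :: "'a::complex_hilbert_space set \<Rightarrow> 'a set \<Rightarrow> 'a operator" where
  "C_zero Lp Lm = (\<lambda>v.
     if v \<in> subspace_sum Lp Lm
     then Some (THE w. \<exists>x\<in>Lp. \<exists>y\<in>Lm. v = x + y \<and> w = x - y) else None)"

definition C_symmetry :: "('a::complex_hilbert_space \<Rightarrow> 'a) \<Rightarrow> 'a operator \<Rightarrow> bool" where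
  "C_symmetry J C \<longleftrightarrow>
     (\<exists>Lp Lm. dual_maximal_definite J Lp Lm \<and>
        closure (subspace_sum Lp Lm) = UNIV \<and> C = C_zero Lp Lm)"

text \<open>The condition \<open>G (J G x) = J x\<close>, with \<open>J G x\<close> in the domain of \<open>G\<close>, says
  \<open>J G x = G\<^sup>-\<^sup>1 J x\<close>.\<close>

definition quasi_maximal ::
    "('a::complex_hilbert_space \<Rightarrow> 'a) \<Rightarrow> 'a set \<Rightarrow> 'a set \<Rightarrow> bool" where
  "quasi_maximal J Lp Lm \<longleftrightarrow>
     dual_definite J Lp Lm \<and> closure (subspace_sum Lp Lm) = UNIV \<and>
     (\<exists>G. selfadjoint G \<and> positive_operator G \<and>
        lmult J (C_zero Lp Lm) \<subseteq>\<^sub>m G \<and>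
        (\<forall>x\<in>dom G. G (J (G \<cdot> x)) = Some (J x)) \<and>
        Dense (H_G G) (H_G_embed G ` subspace_sum Lp Lm))"


section \<open>Quasi bases\<close>

definition complete_J_orthonormal ::
    "('a::complex_hilbert_space \<Rightarrow> 'a) \<Rightarrow> (nat \<Rightarrow> 'a) \<Rightarrow> bool" where
  "complete_J_orthonormal J f \<longleftrightarrow>
     (\<forall>n m. cmod (indef J (f n) (f m)) = (if n = m then 1 else 0)) \<and>
     closure (complex_vector.span (range f)) = UNIV"

definition L_plus :: "('a::complex_hilbert_space \<Rightarrow> 'a) \<Rightarrow> (nat \<Rightarrow> 'a) \<Rightarrow> 'a set" where
  "L_plus J f = closure (complex_vector.span {f n | n. indef J (f n) (f n) = 1})"

definition L_minus :: "('a::complex_hilbert_space \<Rightarrow> 'a) \<Rightarrow> (nat \<Rightarrow> 'a) \<Rightarrow> 'a set" where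
  "L_minus J f = closure (complex_vector.span {f n | n. indef J (f n) (f n) = -1})"

definition quasi_basis :: "('a::complex_hilbert_space \<Rightarrow> 'a) \<Rightarrow> (nat \<Rightarrow> 'a) \<Rightarrow> bool" where
  "quasi_basis J f \<longleftrightarrow>
     complete_J_orthonormal J f \<and> quasi_maximal J (L_plus J f) (L_minus J f)"

end

theory Submission
  imports Defs
begin

text \<open>Both series are Fourier expansions of \<open>C g\<close>, one with respect to \<open>f n\<close> in the space of the form
  \<open>(G x, y)\<close>, the other with respect to \<open>e n = R f n\<close> in the given Hilbert space, where \<open>G = J C = exp Q\<close>
  and \<open>R = exp (Q / 2)\<close>. What has to be found are the coefficients.

  The first coefficient is \<open>(G C g, f n)\<close>. Since \<open>C\<^sup>2 = 1\<close> on the domain of \<open>C\<close>, we have \<open>G C = J\<close>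
  there, and the coefficient is \<open>(J g, f n) = [g, f n]\<close>. The whole expansion takes place in the image of the
  canonical embedding, where the completion is just the domain of \<open>G\<close> with the form norm
  (\<open>Sums_Fourier_embed\<close>).

  The second coefficient is \<open>(C g, e n) = (J G g, e n) = (G g, J e n)\<close>. By hypothesis \<open>J e n = r (e n)\<close>
  with \<open>r = 1\<close> or \<open>r = -1\<close>. On the other hand \<open>C\<close> extends the operator associated with the sequence, so
  \<open>C (f n) = s (f n)\<close> with the sign \<open>s = [f n, f n]\<close>, that is, \<open>G f n = s J f n\<close>. As functions of \<open>Q\<close>,
  \<open>G\<close> and \<open>R\<close> satisfy \<open>(G g, R f n) = (R g, G f n)\<close>, so the coefficient equals
  \<open>r (R g, G f n) = r s (R g, J f n) = r s [R g, f n]\<close>.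

  It remains to see \<open>r s = 1\<close>. The rules \<open>J e n = r (e n)\<close> and \<open>G f n = s J f n\<close> give
  \<open>(G f n, R f n) = r s (R f n, f n)\<close>, and Cauchy-Schwarz for the positive form of \<open>R\<close> gives
  \<open>1 = \<parallel>R f n\<parallel>\<^sup>4 \<le> (R f n, f n) (G f n, R f n) = r s (R f n, f n)\<^sup>2\<close>, which excludes \<open>r s = -1\<close>. The two
  facts used about \<open>G\<close> and \<open>R\<close> are obtained for the integrals of \<open>\<upsilon>\<^sup>4\<close> and \<open>\<upsilon>\<^sup>2\<close> with respect to any
  spectral measure, by approximation with simple functions (\<open>spectral_integral_square_root\<close>), and
  applied to \<open>\<upsilon> t = exp (t / 4)\<close>.\<close>


section \<open>Semidefinite Hermitian forms and Fourier expansions\<close>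

locale hermitian_form =
  fixes D :: "'a::complex_hilbert_space set" and B :: "'a \<Rightarrow> 'a \<Rightarrow> complex"
  assumes subspace_D: "complex_vector.subspace D"
    and form_add_left: "\<lbrakk>x \<in> D; y \<in> D; z \<in> D\<rbrakk> \<Longrightarrow> B (x + y) z = B x z + B y z"
    and form_scale_left: "\<lbrakk>x \<in> D; y \<in> D\<rbrakk> \<Longrightarrow> B (c *\<^sub>C x) y = c * B x y"
    and form_commute: "\<lbrakk>x \<in> D; y \<in> D\<rbrakk> \<Longrightarrow> B x y = cnj (B y x)"
    and form_nonneg: "x \<in> D \<Longrightarrow> 0 \<le> Re (B x x)"
begin

lemmas D_zero = complex_vector.subspace_0[OF subspace_D]
  and D_add = complex_vector.subspace_add[OF subspace_D]
  and D_diff = complex_vector.subspace_diff[OF subspace_D]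
  and D_neg = complex_vector.subspace_neg[OF subspace_D]
  and D_scale = complex_vector.subspace_scale[OF subspace_D]
  and D_sum = complex_vector.subspace_sum[OF subspace_D]

lemma form_diff_left:
  assumes "x \<in> D" "y \<in> D" "z \<in> D"
  shows "B (x - y) z = B x z - B y z"
  using form_add_left[of "x - y" y z] assms by (simp add: D_diff)

lemma form_zero_left: "y \<in> D \<Longrightarrow> B 0 y = 0"
  using form_add_left[of 0 0 y] by (simp add: D_zero)

lemma form_sum_left:
  assumes "y \<in> D" "\<And>i. i \<in> I \<Longrightarrow> u i \<in> D"
  shows "B (\<Sum>i\<in>I. u i) y = (\<Sum>i\<in>I. B (u i) y)"
  using assms(2)
proof (induction I rule: infinite_finite_induct)
  case (insert i I)
  then show ?case
    using form_add_left[of "u i" "\<Sum>i\<in>I. u i" y] assms(1) by (simp add: D_sum)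
qed (simp_all add: form_zero_left assms(1))

lemma form_add_right:
  assumes "x \<in> D" "y \<in> D" "z \<in> D"
  shows "B x (y + z) = B x y + B x z"
  using form_commute[of x] form_add_left[of y z x] assms by (simp add: D_add)

lemma form_diff_right:
  assumes "x \<in> D" "y \<in> D" "z \<in> D"
  shows "B x (y - z) = B x y - B x z"
  using form_commute[of x] form_diff_left[of y z x] assms by (simp add: D_diff)

lemma form_scale_right:
  assumes "x \<in> D" "y \<in> D"
  shows "B x (c *\<^sub>C y) = cnj c * B x y"
  using form_commute[of x] form_scale_left[of y x c] assms by (simp add: D_scale)

lemma form_sum_right:
  assumes "x \<in> D" "\<And>i. i \<in> I \<Longrightarrow> u i \<in> D"
  shows "B x (\<Sum>i\<in>I. u i) = (\<Sum>i\<in>I. B x (u i))"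
proof -
  have "B x (\<Sum>i\<in>I. u i) = cnj (B (\<Sum>i\<in>I. u i) x)"
    using assms by (intro form_commute D_sum) auto
  also have "\<dots> = (\<Sum>i\<in>I. cnj (B (u i) x))"
    using assms by (simp add: form_sum_left)
  also have "\<dots> = (\<Sum>i\<in>I. B x (u i))"
    using assms form_commute[of x] by (intro sum.cong) auto
  finally show ?thesis .
qed

lemma form_norm_nonneg: "x \<in> D \<Longrightarrow> 0 \<le> form_norm B x"
  by (simp add: form_norm_def form_nonneg)

lemma form_norm_square: "x \<in> D \<Longrightarrow> (form_norm B x)\<^sup>2 = Re (B x x)"
  by (simp add: form_norm_def form_nonneg)

lemma form_norm_zero: "form_norm B 0 = 0"
  by (simp add: form_norm_def form_zero_left D_zero)

lemma form_norm_scale: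
  assumes "x \<in> D"
  shows "form_norm B (c *\<^sub>C x) = cmod c * form_norm B x"
proof -
  have "B (c *\<^sub>C x) (c *\<^sub>C x) = (c * cnj c) * B x x"
    using assms by (simp add: form_scale_left form_scale_right D_scale)
  also have "\<dots> = complex_of_real ((cmod c)\<^sup>2) * B x x"
    by (simp add: complex_norm_square[symmetric])
  finally have "Re (B (c *\<^sub>C x) (c *\<^sub>C x)) = (cmod c)\<^sup>2 * Re (B x x)"
    by simp
  then show ?thesis
    by (simp add: form_norm_def real_sqrt_mult)
qed

lemma form_norm_minus_commute:
  assumes "x \<in> D" "y \<in> D"
  shows "form_norm B (x - y) = form_norm B (y - x)"
proof -
  have "B (x - y) (x - y) = B (y - x) (y - x)"
    using assms by (simp add: form_diff_left form_diff_right D_diff)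
  then show ?thesis
    by (simp add: form_norm_def)
qed

text \<open>The form may degenerate, so the usual division by \<open>B y y\<close> is replaced by the nonnegativity
  of the quadratic polynomial \<open>r \<mapsto> B (x - r b y) (x - r b y)\<close>, \<open>b = B x y\<close>, at every real \<open>r\<close>.\<close>

lemma form_Cauchy_Schwarz:
  assumes "x \<in> D" "y \<in> D"
  shows "cmod (B x y) \<le> form_norm B x * form_norm B y"
proof -
  define b where "b = B x y"
  define p where "p = Re (B x x)"
  define q where "q = Re (B y y)"
  have pq: "p \<ge> 0" "q \<ge> 0"
    using assms by (auto simp: p_def q_def form_nonneg)
  have bc: "b * cnj b = complex_of_real ((cmod b)\<^sup>2)"
    by (rule complex_norm_square[symmetric])
  have poly: "0 \<le> p - 2 * r * (cmod b)\<^sup>2 + r\<^sup>2 * (cmod b)\<^sup>2 * q" for r :: real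
  proof -
    define c where "c = complex_of_real r * b"
    have yx: "B y x = cnj b"
      using form_commute[of y x] assms by (simp add: b_def)
    have "B (x - c *\<^sub>C y) (x - c *\<^sub>C y) = B x x - cnj c * b - c * cnj b + c * cnj c * B y y"
      using assms yx
      by (simp add: form_diff_left form_diff_right form_scale_left form_scale_right D_diff D_scale
          b_def[symmetric] algebra_simps)
    also have "\<dots> = B x x - of_real (2 * r * (cmod b)\<^sup>2) + of_real (r\<^sup>2 * (cmod b)\<^sup>2) * B y y"
      unfolding c_def of_real_mult bc[symmetric] by (simp add: algebra_simps power2_eq_square)
    finally have "Re (B (x - c *\<^sub>C y) (x - c *\<^sub>C y)) = p - 2 * r * (cmod b)\<^sup>2 + r\<^sup>2 * (cmod b)\<^sup>2 * q"
      unfolding p_def q_def by simp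
    then show ?thesis
      using form_nonneg[of "x - c *\<^sub>C y"] assms by (simp add: D_diff D_scale)
  qed
  have "(cmod b)\<^sup>2 \<le> p * q"
  proof (cases "q = 0")
    case True
    have "(cmod b)\<^sup>2 = 0"
    proof (rule ccontr)
      assume "(cmod b)\<^sup>2 \<noteq> 0"
      then show False
        using poly[of "(p + 1) / (2 * (cmod b)\<^sup>2)"] True by simp
    qed
    then show ?thesis
      using True by simp
  next
    case False
    then have "q > 0" using pq by simp
    then have "0 \<le> p - (cmod b)\<^sup>2 / q"
      using poly[of "1 / q"] by (simp add: power2_eq_square)
    then show ?thesis
      using \<open>q > 0\<close> by (simp add: field_simps)
  qed
  then have "cmod b \<le> sqrt (p * q)"
    by (rule real_le_rsqrt)
  then show ?thesis
    by (simp add: form_norm_def b_def p_def q_def real_sqrt_mult)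
qed

lemma form_norm_add:
  assumes "x \<in> D" "y \<in> D"
  shows "(form_norm B (x + y))\<^sup>2 = (form_norm B x)\<^sup>2 + 2 * Re (B x y) + (form_norm B y)\<^sup>2"
  using assms form_commute[of y x]
  by (simp add: form_norm_square form_add_left form_add_right D_add)

lemma form_norm_triangle:
  assumes "x \<in> D" "y \<in> D"
  shows "form_norm B (x + y) \<le> form_norm B x + form_norm B y"
proof (rule power2_le_imp_le)
  have "Re (B x y) \<le> form_norm B x * form_norm B y"
    using form_Cauchy_Schwarz[OF assms] complex_Re_le_cmod[of "B x y"] by linarith
  then show "(form_norm B (x + y))\<^sup>2 \<le> (form_norm B x + form_norm B y)\<^sup>2"
    using assms by (simp add: form_norm_add power2_sum)
qed (simp add: assms form_norm_nonneg)

lemma form_norm_null: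
  assumes "\<And>n. w n \<in> D" "\<And>n. form_norm B (w n) \<le> g n" "g \<longlonglongrightarrow> 0"
  shows "(\<lambda>n. form_norm B (w n)) \<longlonglongrightarrow> 0"
  by (rule tendsto_sandwich[OF _ _ tendsto_const assms(3)]) (simp_all add: assms form_norm_nonneg)

lemma form_norm_triangle_diff:
  assumes "x \<in> D" "y \<in> D" "z \<in> D"
  shows "form_norm B (x - z) \<le> form_norm B (x - y) + form_norm B (y - z)"
  using form_norm_triangle[of "x - y" "y - z"] assms by (simp add: D_diff)

lemma form_tendsto:
  assumes "\<And>n. u n \<in> D" "x \<in> D" "\<And>n. v n \<in> D" "y \<in> D"
    and u: "(\<lambda>n. form_norm B (u n - x)) \<longlonglongrightarrow> 0"
    and v: "(\<lambda>n. form_norm B (v n - y)) \<longlonglongrightarrow> 0"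
  shows "(\<lambda>n. B (u n) (v n)) \<longlonglongrightarrow> B x y"
proof -
  have bound: "cmod (B (u n) (v n) - B x y) \<le>
      form_norm B (u n - x) * form_norm B (v n - y)
      + form_norm B (u n - x) * form_norm B y + form_norm B x * form_norm B (v n - y)" for n
  proof -
    have "B (u n) (v n) - B x y = B (u n - x) (v n - y) + B (u n - x) y + B x (v n - y)"
      using assms by (simp add: form_diff_left form_diff_right D_diff)
    then have "cmod (B (u n) (v n) - B x y)
        \<le> cmod (B (u n - x) (v n - y)) + cmod (B (u n - x) y) + cmod (B x (v n - y))"
      by (metis norm_triangle_ineq add_right_mono order_trans)
    also have "\<dots> \<le> form_norm B (u n - x) * form_norm B (v n - y)
      + form_norm B (u n - x) * form_norm B y + form_norm B x * form_norm B (v n - y)"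
      using assms by (intro add_mono form_Cauchy_Schwarz D_diff)
    finally show ?thesis .
  qed
  have "(\<lambda>n. form_norm B (u n - x) * form_norm B (v n - y)
      + form_norm B (u n - x) * form_norm B y + form_norm B x * form_norm B (v n - y)) \<longlonglongrightarrow> 0"
    by (rule tendsto_eq_intros u v refl)+ simp
  then have "(\<lambda>n. B (u n) (v n) - B x y) \<longlonglongrightarrow> 0"
    by (rule Lim_null_comparison[rotated]) (use bound in auto)
  then show ?thesis
    by (simp add: LIM_zero_iff)
qed

text \<open>The residual \<open>x - P\<close> of a Fourier partial sum \<open>P\<close> is orthogonal to the vectors used so far,
  so by Pythagoras \<open>P\<close> is at least as close to \<open>x\<close> as any other combination of them. One good
  approximation by a finite combination therefore controls all later partial sums.\<close>

lemma Fourier_partial_sums_tendsto: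
  assumes "x \<in> D" "\<And>n. e n \<in> D"
    and orth: "\<And>n m. B (e n) (e m) = (if n = m then 1 else 0)"
    and dense: "\<And>\<epsilon>. \<epsilon> > 0 \<Longrightarrow> \<exists>c N. form_norm B ((\<Sum>n<N. c n *\<^sub>C e n) - x) < \<epsilon>"
  shows "(\<lambda>N. form_norm B ((\<Sum>n<N. B x (e n) *\<^sub>C e n) - x)) \<longlonglongrightarrow> 0"
proof (rule LIMSEQ_I)
  fix \<epsilon> :: real
  assume "\<epsilon> > 0"
  then obtain c N0 where c: "form_norm B ((\<Sum>n<N0. c n *\<^sub>C e n) - x) < \<epsilon>"
    using dense by blast
  have in_D: "(\<Sum>n<N. a n *\<^sub>C e n) \<in> D" for a N
    using assms by (intro D_sum D_scale)
  have "form_norm B ((\<Sum>n<N. B x (e n) *\<^sub>C e n) - x) < \<epsilon>" if "N \<ge> N0" for N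
  proof -
    define d where "d n = (if n < N0 then c n else 0)" for n
    define P where "P = (\<Sum>n<N. B x (e n) *\<^sub>C e n)"
    have P: "P \<in> D"
      unfolding P_def by (rule in_D)
    have pad: "(\<Sum>n<N. d n *\<^sub>C e n) = (\<Sum>n<N0. c n *\<^sub>C e n)"
      using that unfolding d_def by (intro sum.mono_neutral_cong_right) auto
    have residual: "B (P - x) (e m) = 0" if "m < N" for m
    proof -
      have "B P (e m) = (\<Sum>n<N. B x (e n) * B (e n) (e m))"
        unfolding P_def using assms by (simp add: form_sum_left form_scale_left D_scale)
      also have "\<dots> = (\<Sum>n<N. if n = m then B x (e m) else 0)"
        by (intro sum.cong) (auto simp: orth)
      also have "\<dots> = B x (e m)"
        using that by simp
      finally show ?thesis
        using assms P by (simp add: form_diff_left)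
    qed
    define w where "w = (\<Sum>n<N. (d n - B x (e n)) *\<^sub>C e n)"
    have w: "w \<in> D"
      unfolding w_def by (rule in_D)
    have "B (P - x) w = (\<Sum>n<N. cnj (d n - B x (e n)) * B (P - x) (e n))"
      unfolding w_def using assms P by (simp add: form_sum_right form_scale_right D_scale D_diff)
    also have "\<dots> = 0"
      using residual by simp
    finally have "B (P - x) w = 0" .
    have shift: "(P - x) + w = (\<Sum>n<N0. c n *\<^sub>C e n) - x"
      unfolding pad[symmetric] P_def w_def
      by (simp add: complex_vector.scale_left_diff_distrib sum_subtractf)
    have "(form_norm B ((\<Sum>n<N0. c n *\<^sub>C e n) - x))\<^sup>2
        = (form_norm B (P - x))\<^sup>2 + (form_norm B w)\<^sup>2"
      unfolding shift[symmetric] using form_norm_add[of "P - x" w] assms(1) P w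
        \<open>B (P - x) w = 0\<close> by (simp add: D_diff)
    then have "(form_norm B (P - x))\<^sup>2 \<le> (form_norm B ((\<Sum>n<N0. c n *\<^sub>C e n) - x))\<^sup>2"
      by simp
    then have "form_norm B (P - x) \<le> form_norm B ((\<Sum>n<N0. c n *\<^sub>C e n) - x)"
      by (rule power2_le_imp_le) (use in_D assms in \<open>simp add: form_norm_nonneg D_diff\<close>)
    then show ?thesis
      using c P_def by simp
  qed
  then show "\<exists>N0. \<forall>N\<ge>N0. norm (form_norm B ((\<Sum>n<N. B x (e n) *\<^sub>C e n) - x) - 0) < \<epsilon>"
    using in_D assms by (auto simp: form_norm_nonneg D_diff)
qed


section \<open>The completion on the image of its canonical embedding\<close>

text \<open>The first expansion takes place inside the image of \<open>D\<close>. There the operations of the completion,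
  which are defined through chosen representatives, reduce to those of \<open>D\<close>, because a
  representative of the class of \<open>x\<close> is a sequence in \<open>D\<close> converging to \<open>x\<close> in the form norm.\<close>

abbreviation embed :: "'a \<Rightarrow> (nat \<Rightarrow> 'a) set" where
  "embed x \<equiv> form_class D B (\<lambda>_. x)"

lemma const_in_form_Cauchy: "x \<in> D \<Longrightarrow> (\<lambda>_. x) \<in> form_Cauchy D B"
  by (simp add: form_Cauchy_def form_norm_zero image_subset_iff)

lemma convergent_in_form_Cauchy:
  assumes "\<And>n. u n \<in> D" "x \<in> D" "(\<lambda>n. form_norm B (u n - x)) \<longlonglongrightarrow> 0"
  shows "u \<in> form_Cauchy D B"
  unfolding form_Cauchy_def
proof (intro CollectI conjI allI impI)
  show "range u \<subseteq> D"
    using assms by auto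
next
  fix \<epsilon> :: real
  assume "\<epsilon> > 0"
  then obtain N where N: "\<And>n. n \<ge> N \<Longrightarrow> form_norm B (u n - x) < \<epsilon> / 2"
    using LIMSEQ_D[OF assms(3), of "\<epsilon> / 2"] by fastforce
  have "form_norm B (u m - u n) < \<epsilon>" if "m \<ge> N" "n \<ge> N" for m n
    using form_norm_triangle_diff[of "u m" x "u n"] form_norm_minus_commute[of x "u n"]
      N[OF that(1)] N[OF that(2)] assms by simp
  then show "\<exists>N. \<forall>m\<ge>N. \<forall>n\<ge>N. form_norm B (u m - u n) < \<epsilon>"
    by blast
qed

lemma mem_embed_iff:
  assumes "x \<in> D"
  shows "u \<in> embed x \<longleftrightarrow> (\<forall>n. u n \<in> D) \<and> (\<lambda>n. form_norm B (u n - x)) \<longlonglongrightarrow> 0"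
proof
  assume "u \<in> embed x"
  then have "u \<in> form_Cauchy D B" and lim: "(\<lambda>n. form_norm B (x - u n)) \<longlonglongrightarrow> 0"
    by (auto simp: form_class_def form_rel_def)
  then have "\<And>n. u n \<in> D"
    by (auto simp: form_Cauchy_def)
  then show "(\<forall>n. u n \<in> D) \<and> (\<lambda>n. form_norm B (u n - x)) \<longlonglongrightarrow> 0"
    using lim assms by (simp add: form_norm_minus_commute[of _ x])
next
  assume u: "(\<forall>n. u n \<in> D) \<and> (\<lambda>n. form_norm B (u n - x)) \<longlonglongrightarrow> 0"
  then have "(\<lambda>n. form_norm B (x - u n)) \<longlonglongrightarrow> 0"
    using assms by (simp add: form_norm_minus_commute[of x])
  then show "u \<in> embed x"
    using u assms convergent_in_form_Cauchy[of u x] const_in_form_Cauchy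
    by (auto simp: form_class_def form_rel_def)
qed

lemma form_class_eq_embed:
  assumes "x \<in> D" "\<And>n. u n \<in> D" and lim: "(\<lambda>n. form_norm B (u n - x)) \<longlonglongrightarrow> 0"
  shows "form_class D B u = embed x"
proof -
  have u: "u \<in> form_Cauchy D B"
    using assms by (intro convergent_in_form_Cauchy)
  have "v \<in> form_class D B u \<longleftrightarrow> v \<in> embed x" for v
  proof
    assume "v \<in> form_class D B u"
    then have v: "\<And>n. v n \<in> D" and uv: "(\<lambda>n. form_norm B (u n - v n)) \<longlonglongrightarrow> 0"
      by (auto simp: form_class_def form_rel_def form_Cauchy_def)
    have "(\<lambda>n. form_norm B (u n - v n) + form_norm B (u n - x)) \<longlonglongrightarrow> 0"
      using tendsto_add[OF uv lim] by simp
    moreover have "form_norm B (v n - x) \<le> form_norm B (u n - v n) + form_norm B (u n - x)" for n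
      using form_norm_triangle_diff[of "v n" "u n" x] form_norm_minus_commute[of "v n" "u n"]
        assms v by simp
    ultimately have "(\<lambda>n. form_norm B (v n - x)) \<longlonglongrightarrow> 0"
      using assms v by (intro form_norm_null[where g = "\<lambda>n. form_norm B (u n - v n) + form_norm B (u n - x)"] D_diff)
    then show "v \<in> embed x"
      using assms v by (simp add: mem_embed_iff)
  next
    assume "v \<in> embed x"
    then have v: "\<And>n. v n \<in> D" and vx: "(\<lambda>n. form_norm B (v n - x)) \<longlonglongrightarrow> 0"
      using assms by (auto simp: mem_embed_iff)
    have "(\<lambda>n. form_norm B (u n - x) + form_norm B (v n - x)) \<longlonglongrightarrow> 0"
      using tendsto_add[OF lim vx] by simp
    moreover have "form_norm B (u n - v n) \<le> form_norm B (u n - x) + form_norm B (v n - x)" for n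
      using form_norm_triangle_diff[of "u n" x "v n"] form_norm_minus_commute[of x "v n"]
        assms v by simp
    ultimately have "(\<lambda>n. form_norm B (u n - v n)) \<longlonglongrightarrow> 0"
      using assms v by (intro form_norm_null[where g = "\<lambda>n. form_norm B (u n - x) + form_norm B (v n - x)"] D_diff)
    then show "v \<in> form_class D B u"
      using u convergent_in_form_Cauchy[OF v _ vx] assms
      by (simp add: form_class_def form_rel_def)
  qed
  then show ?thesis
    by blast
qed

lemma representative_embed:
  assumes "x \<in> D"
  shows "representative (embed x) n \<in> D"
    and "(\<lambda>n. form_norm B (representative (embed x) n - x)) \<longlonglongrightarrow> 0"
proof -
  have "(\<lambda>_. x) \<in> embed x"
    using assms by (simp add: mem_embed_iff form_norm_zero)
  then have "representative (embed x) \<in> embed x"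
    unfolding representative_def by (rule someI[of "\<lambda>u. u \<in> embed x"])
  then show "representative (embed x) n \<in> D"
    "(\<lambda>n. form_norm B (representative (embed x) n - x)) \<longlonglongrightarrow> 0"
    using assms by (auto simp: mem_embed_iff)
qed

lemma Zero_completion: "Zero (completion D B) = embed 0"
  by (simp add: completion_def)

lemma Inner_embed:
  assumes "x \<in> D" "y \<in> D"
  shows "Inner (completion D B) (embed x) (embed y) = B x y"
proof -
  have "(\<lambda>n. B (representative (embed x) n) (representative (embed y) n)) \<longlonglongrightarrow> B x y"
    using assms by (intro form_tendsto representative_embed)
  then show ?thesis
    by (simp add: completion_def limI)
qed

lemma Scale_embed:
  assumes "x \<in> D"
  shows "Scale (completion D B) c (embed x) = embed (c *\<^sub>C x)"
proof -
  let ?r = "representative (embed x)"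
  have "form_norm B (c *\<^sub>C ?r n - c *\<^sub>C x) = cmod c * form_norm B (?r n - x)" for n
    using assms representative_embed[OF assms]
    by (simp add: complex_vector.scale_right_diff_distrib[symmetric] form_norm_scale D_diff)
  moreover have "(\<lambda>n. cmod c * form_norm B (?r n - x)) \<longlonglongrightarrow> 0"
    using tendsto_mult_right_zero[OF representative_embed(2)[OF assms]] .
  ultimately have "form_class D B (\<lambda>n. c *\<^sub>C ?r n) = embed (c *\<^sub>C x)"
    using assms representative_embed[OF assms] by (intro form_class_eq_embed) (auto simp: D_scale)
  then show ?thesis
    by (simp add: completion_def)
qed

lemma Add_embed:
  assumes "x \<in> D" "y \<in> D"
  shows "Add (completion D B) (embed x) (embed y) = embed (x + y)"
proof -
  let ?r = "representative (embed x)" and ?s = "representative (embed y)"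
  note r = representative_embed[OF assms(1)] and s = representative_embed[OF assms(2)]
  have "(\<lambda>n. form_norm B (?r n - x) + form_norm B (?s n - y)) \<longlonglongrightarrow> 0"
    using tendsto_add[OF r(2) s(2)] by simp
  moreover have "form_norm B (?r n + ?s n - (x + y))
      \<le> form_norm B (?r n - x) + form_norm B (?s n - y)" for n
    using form_norm_triangle[of "?r n - x" "?s n - y"] assms r(1) s(1)
    by (simp add: D_diff algebra_simps)
  ultimately have "(\<lambda>n. form_norm B (?r n + ?s n - (x + y))) \<longlonglongrightarrow> 0"
    using assms r(1) s(1)
    by (intro form_norm_null[where g = "\<lambda>n. form_norm B (?r n - x) + form_norm B (?s n - y)"] D_diff D_add)
  then have "form_class D B (\<lambda>n. ?r n + ?s n) = embed (x + y)"
    using assms r(1) s(1) by (intro form_class_eq_embed) (auto simp: D_add)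
  then show ?thesis
    by (simp add: completion_def)
qed

lemma Dist_embed:
  assumes "x \<in> D" "y \<in> D"
  shows "Dist (completion D B) (embed x) (embed y) = form_norm B (x - y)"
  using assms
  by (simp add: Dist_def Let_def Scale_embed Add_embed Inner_embed D_scale D_add D_diff D_neg
      form_norm_def complex_vector.scale_minus_left scaleC_one)

lemma Psum_embed:
  assumes "\<And>n. u n \<in> D"
  shows "Psum (completion D B) (\<lambda>n. Scale (completion D B) (c n) (embed (u n))) N
    = embed (\<Sum>n<N. c n *\<^sub>C u n)"
  using assms
  by (induction N) (simp_all add: Zero_completion Scale_embed Add_embed D_scale D_sum)

lemma embed_in_Carrier: "x \<in> D \<Longrightarrow> embed x \<in> Carrier (completion D B)"
  using const_in_form_Cauchy[of x] by (simp add: completion_def form_class_def quotientI)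

lemma Sums_Fourier_embed:
  assumes "x \<in> D" "\<And>n. e n \<in> D"
    and basis: "Orthonormal_Basis (completion D B) (\<lambda>n. embed (e n))"
  shows "Sums (completion D B) (\<lambda>n. Scale (completion D B) (B x (e n)) (embed (e n))) (embed x)"
proof -
  have in_D: "(\<Sum>n<N. a n *\<^sub>C e n) \<in> D" for a N
    using assms by (intro D_sum D_scale)
  have "B (e n) (e m) = (if n = m then 1 else 0)" for n m
    using basis Inner_embed[of "e n" "e m"] assms by (simp add: Orthonormal_Basis_def)
  moreover have "\<exists>c N. form_norm B ((\<Sum>n<N. c n *\<^sub>C e n) - x) < \<epsilon>" if "\<epsilon> > 0" for \<epsilon>
  proof -
    have "\<exists>y\<in>{Psum (completion D B) (\<lambda>n. Scale (completion D B) (c n) (embed (e n))) N | c N. True}.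
        Dist (completion D B) y (embed x) < \<epsilon>"
      using basis that embed_in_Carrier[OF assms(1)]
      unfolding Orthonormal_Basis_def Dense_def by blast
    then obtain c N where "Dist (completion D B) (Psum (completion D B)
        (\<lambda>n. Scale (completion D B) (c n) (embed (e n))) N) (embed x) < \<epsilon>"
      by blast
    then have "form_norm B ((\<Sum>n<N. c n *\<^sub>C e n) - x) < \<epsilon>"
      using assms in_D by (simp add: Psum_embed Dist_embed)
    then show ?thesis
      by blast
  qed
  ultimately have "(\<lambda>N. form_norm B ((\<Sum>n<N. B x (e n) *\<^sub>C e n) - x)) \<longlonglongrightarrow> 0"
    using assms by (intro Fourier_partial_sums_tendsto)
  then show ?thesis
    using assms in_D by (simp add: Sums_def Psum_embed Dist_embed)
qed

end


section \<open>The inner product of the Hilbert space\<close>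

lemma cinner_self_nonneg: "0 \<le> Re (cinner x x)"
  using norm_eq_sqrt_cinner[of x] norm_ge_zero[of x] by (metis real_sqrt_ge_0_iff)

interpretation cinner_form: hermitian_form UNIV cinner
  by unfold_locales
    (use cinner_commute in \<open>auto simp: cinner_add_left cinner_scaleC_left cinner_self_nonneg\<close>)

lemmas cinner_diff_left = cinner_form.form_diff_left[OF UNIV_I UNIV_I UNIV_I]
  and cinner_sum_left = cinner_form.form_sum_left[OF UNIV_I UNIV_I]
  and cinner_add_right = cinner_form.form_add_right[OF UNIV_I UNIV_I UNIV_I]
  and cinner_scaleC_right = cinner_form.form_scale_right[OF UNIV_I UNIV_I]
  and cinner_sum_right = cinner_form.form_sum_right[OF UNIV_I UNIV_I]

lemma form_norm_cinner: "form_norm cinner x = norm x"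
  by (simp add: form_norm_def norm_eq_sqrt_cinner)

lemma norm_square_cinner: "(norm x)\<^sup>2 = Re (cinner x x)"
  using cinner_form.form_norm_square[of x] by (simp add: form_norm_cinner)

lemma cinner_Cauchy_Schwarz: "cmod (cinner x y) \<le> norm x * norm y"
  using cinner_form.form_Cauchy_Schwarz[of x y] by (simp add: form_norm_cinner)

lemma cinner_scaleR_left: "cinner (r *\<^sub>R x) y = of_real r * cinner x y"
  by (simp add: scaleR_scaleC cinner_scaleC_left)

lemma cinner_scaleR_right: "cinner x (r *\<^sub>R y) = of_real r * cinner x y"
  by (simp add: scaleR_scaleC cinner_scaleC_right)

lemma tendsto_cinner:
  assumes "u \<longlonglongrightarrow> x" "v \<longlonglongrightarrow> y"
  shows "(\<lambda>n. cinner (u n) (v n)) \<longlonglongrightarrow> cinner x y"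
proof (rule cinner_form.form_tendsto)
  show "(\<lambda>n. form_norm cinner (u n - x)) \<longlonglongrightarrow> 0"
    using assms(1) by (simp add: form_norm_cinner LIM_zero tendsto_norm_zero)
  show "(\<lambda>n. form_norm cinner (v n - y)) \<longlonglongrightarrow> 0"
    using assms(2) by (simp add: form_norm_cinner LIM_zero tendsto_norm_zero)
qed auto

lemma bounded_linear_Re_cinner: "bounded_linear (\<lambda>x. Re (cinner x y))"
proof (rule bounded_linear_intro)
  show "norm (Re (cinner x y)) \<le> norm x * norm y" for x
    using abs_Re_le_cmod[of "cinner x y"] cinner_Cauchy_Schwarz[of x y] by simp
qed (simp_all add: cinner_add_left cinner_scaleR_left)

lemma mem_span_rangeE:
  fixes e :: "nat \<Rightarrow> 'a::complex_hilbert_space"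
  assumes "x \<in> complex_vector.span (range e)"
  obtains c N where "x = (\<Sum>n<N. c n *\<^sub>C e n)"
proof -
  have "\<exists>c N. x = (\<Sum>n<N. c n *\<^sub>C e n)"
    using assms
  proof (induction rule: complex_vector.span_induct_alt)
    case base
    show ?case
      by (rule exI[of _ "\<lambda>_. 0"], rule exI[of _ 0]) simp
  next
    case (step a v y)
    then obtain k c N where k: "v = e k" and y: "y = (\<Sum>n<N. c n *\<^sub>C e n)"
      by auto
    define M where "M = max N (Suc k)"
    have "y = (\<Sum>n<M. (if n < N then c n else 0) *\<^sub>C e n)"
      unfolding y M_def by (intro sum.mono_neutral_cong_left) auto
    moreover have "a *\<^sub>C v = (\<Sum>n<M. (if n = k then a else 0) *\<^sub>C e n)"
    proof -
      have "(\<Sum>n<M. (if n = k then a else 0) *\<^sub>C e n) = (\<Sum>n<M. if n = k then a *\<^sub>C e n else 0)"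
        by (intro sum.cong) auto
      then show ?thesis
        by (simp add: M_def k less_max_iff_disj)
    qed
    ultimately have "a *\<^sub>C v + y
        = (\<Sum>n<M. ((if n = k then a else 0) + (if n < N then c n else 0)) *\<^sub>C e n)"
      by (simp only: scaleC_add_left sum.distrib)
    then show ?case
      by (intro exI)
  qed
  then show ?thesis
    using that by blast
qed

lemma orthonormal_basis_sums:
  assumes "orthonormal_basis e"
  shows "(\<lambda>n. cinner x (e n) *\<^sub>C e n) sums x"
proof -
  have "(\<lambda>N. form_norm cinner ((\<Sum>n<N. cinner x (e n) *\<^sub>C e n) - x)) \<longlonglongrightarrow> 0"
  proof (rule cinner_form.Fourier_partial_sums_tendsto)
    show "cinner (e n) (e m) = (if n = m then 1 else 0)" for n m
      using assms by (simp add: orthonormal_basis_def)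
    show "\<exists>c N. form_norm cinner ((\<Sum>n<N. c n *\<^sub>C e n) - x) < \<epsilon>" if "\<epsilon> > 0" for \<epsilon>
    proof -
      have "x \<in> closure (complex_vector.span (range e))"
        using assms by (simp add: orthonormal_basis_def)
      then obtain y where y: "y \<in> complex_vector.span (range e)" "dist y x < \<epsilon>"
        using \<open>\<epsilon> > 0\<close> by (auto simp: closure_approachable)
      then obtain c N where "y = (\<Sum>n<N. c n *\<^sub>C e n)"
        by (auto elim: mem_span_rangeE)
      with y show ?thesis
        by (auto simp: form_norm_cinner dist_norm)
    qed
  qed auto
  then show ?thesis
    by (simp add: sums_def form_norm_cinner LIM_zero_iff tendsto_norm_zero_iff)
qed


section \<open>Spectral integrals as limits of simple ones\<close>

locale spectral_family =
  fixes E :: "real set \<Rightarrow> 'a::complex_hilbert_space \<Rightarrow> 'a"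
  assumes spectral_measure: "spectral_measure E"
begin

lemma projection: "B \<in> sets borel \<Longrightarrow> orthogonal_projection (E B)"
  using spectral_measure by (simp add: spectral_measure_def)

lemma projection_linear: "B \<in> sets borel \<Longrightarrow> linear (E B)"
  using projection by (auto simp: orthogonal_projection_def bounded_linear.linear)

lemma projection_symmetric: "B \<in> sets borel \<Longrightarrow> cinner (E B x) y = cinner x (E B y)"
  using projection by (simp add: orthogonal_projection_def)

lemma projection_empty: "E {} x = 0"
  using spectral_measure by (simp add: spectral_measure_def)

lemma projection_Int:
  "A \<in> sets borel \<Longrightarrow> B \<in> sets borel \<Longrightarrow> E A (E B x) = E (A \<inter> B) x"
  using spectral_measure by (simp add: spectral_measure_def)

lemma projection_sums:
  "range A \<subseteq> sets borel \<Longrightarrow> disjoint_family A \<Longrightarrow> (\<lambda>n. E (A n) x) sums E (\<Union>n. A n) x"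
  for A :: "nat \<Rightarrow> real set"
  using spectral_measure by (simp add: spectral_measure_def)

lemma cinner_projection_self: "B \<in> sets borel \<Longrightarrow> Re (cinner (E B x) x) = (norm (E B x))\<^sup>2"
  using projection_symmetric[of B x "E B x"] projection_symmetric[of B "E B x" x]
    projection_Int[of B B x]
  by (simp add: norm_square_cinner)

lemma projection_Un:
  assumes "A \<in> sets borel" "B \<in> sets borel" "A \<inter> B = {}"
  shows "E (A \<union> B) x = E A x + E B x"
proof -
  have "(\<lambda>n. E (binaryset A B n) x) sums E (\<Union>n. binaryset A B n) x"
    using assms by (intro projection_sums)
      (auto simp: range_binaryset_eq disjoint_family_on_def binaryset_def)
  moreover have "(\<lambda>n. E (binaryset A B n) x) sums (\<Sum>n\<in>{0, Suc 0}. E (binaryset A B n) x)"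
    by (rule sums_finite) (auto simp: binaryset_def projection_empty)
  ultimately show ?thesis
    by (auto simp: UN_binaryset_eq binaryset_def dest: sums_unique2)
qed

lemma projection_UN:
  assumes "finite I" "\<And>i. i \<in> I \<Longrightarrow> A i \<in> sets borel" "disjoint_family_on A I"
  shows "E (\<Union>i\<in>I. A i) x = (\<Sum>i\<in>I. E (A i) x)"
  using assms
proof (induction I)
  case empty
  then show ?case
    by (simp add: projection_empty)
next
  case (insert i I)
  have "E (A i \<union> (\<Union>i\<in>I. A i)) x = E (A i) x + E (\<Union>i\<in>I. A i) x"
    using insert by (intro projection_Un) (auto simp: disjoint_family_on_def)
  with insert show ?case
    by (simp add: disjoint_family_on_def)
qed

lemma simple_function_borelD:
  assumes "simple_function borel h"
  shows "finite (range h)" "h -` X \<in> sets borel"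
  using simple_functionD[OF assms] by auto

text \<open>Two simple functions factor through their pair, whose level sets refine those of both. So
  differences, products and squares of simple integrals can be computed on a common partition.\<close>

lemma simple_integral_factor:
  assumes h: "simple_function borel h"
  shows "simple_integral E (\<lambda>t. F (h t)) x = (\<Sum>b\<in>range h. F b *\<^sub>R E (h -` {b}) x)"
proof -
  note fin = simple_function_borelD(1)[OF h] and meas = simple_function_borelD(2)[OF h]
  have "simple_integral E (\<lambda>t. F (h t)) x
      = (\<Sum>c\<in>F ` range h. c *\<^sub>R E ((\<lambda>t. F (h t)) -` {c}) x)"
    by (simp add: simple_integral_def image_image)
  also have "\<dots> = (\<Sum>c\<in>F ` range h. \<Sum>b\<in>{b. b \<in> range h \<and> F b = c}. F b *\<^sub>R E (h -` {b}) x)"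
  proof (rule sum.cong[OF refl])
    fix c
    have "(\<lambda>t. F (h t)) -` {c} = (\<Union>b\<in>{b. b \<in> range h \<and> F b = c}. h -` {b})"
      by auto
    moreover have "E (\<Union>b\<in>{b. b \<in> range h \<and> F b = c}. h -` {b}) x
        = (\<Sum>b\<in>{b. b \<in> range h \<and> F b = c}. E (h -` {b}) x)"
      using fin meas by (intro projection_UN) (auto simp: disjoint_family_on_def)
    ultimately show "c *\<^sub>R E ((\<lambda>t. F (h t)) -` {c}) x
        = (\<Sum>b\<in>{b. b \<in> range h \<and> F b = c}. F b *\<^sub>R E (h -` {b}) x)"
      by (simp add: scaleR_sum_right)
  qed
  also have "\<dots> = (\<Sum>b\<in>range h. F b *\<^sub>R E (h -` {b}) x)"
    by (rule sum.image_gen[symmetric, OF fin])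
  finally show ?thesis .
qed

lemma simple_integral_diff:
  assumes "simple_function borel s" "simple_function borel t"
  shows "simple_integral E (\<lambda>r. s r - t r) x = simple_integral E s x - simple_integral E t x"
proof -
  have h: "simple_function borel (\<lambda>r. (s r, t r))"
    using assms by simp
  show ?thesis
    using simple_integral_factor[OF h, of fst] simple_integral_factor[OF h, of snd]
      simple_integral_factor[OF h, of "\<lambda>b. fst b - snd b"]
    by (simp add: scaleR_diff_left sum_subtractf)
qed

lemma simple_integral_mult:
  assumes "simple_function borel s" "simple_function borel t"
  shows "simple_integral E s (simple_integral E t x) = simple_integral E (\<lambda>r. s r * t r) x"
proof -
  define h where "h r = (s r, t r)" for r
  have h: "simple_function borel h"
    using assms unfolding h_def by simp
  note fin = simple_function_borelD(1)[OF h] and meas = simple_function_borelD(2)[OF h]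
  have s: "simple_integral E s y = (\<Sum>b\<in>range h. fst b *\<^sub>R E (h -` {b}) y)" for y
    using simple_integral_factor[OF h, of fst] by (simp add: h_def)
  have t: "simple_integral E t y = (\<Sum>b\<in>range h. snd b *\<^sub>R E (h -` {b}) y)" for y
    using simple_integral_factor[OF h, of snd] by (simp add: h_def)
  have "E (h -` {b}) (simple_integral E t x) = snd b *\<^sub>R E (h -` {b}) x" if "b \<in> range h" for b
  proof -
    have "E (h -` {b}) (simple_integral E t x)
        = (\<Sum>b'\<in>range h. snd b' *\<^sub>R E (h -` {b}) (E (h -` {b'}) x))"
      unfolding t using projection_linear[OF meas]
      by (simp add: linear_sum linear_cmul)
    also have "\<dots> = (\<Sum>b'\<in>range h. if b' = b then snd b *\<^sub>R E (h -` {b}) x else 0)"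
    proof (rule sum.cong[OF refl])
      fix b'
      have "h -` {b} \<inter> h -` {b'} = (if b' = b then h -` {b} else {})"
        by auto
      then show "snd b' *\<^sub>R E (h -` {b}) (E (h -` {b'}) x)
          = (if b' = b then snd b *\<^sub>R E (h -` {b}) x else 0)"
        using projection_Int[OF meas meas, of "{b}" "{b'}" x] by (simp add: projection_empty)
    qed
    also have "\<dots> = snd b *\<^sub>R E (h -` {b}) x"
      using fin that by simp
    finally show ?thesis .
  qed
  then have "simple_integral E s (simple_integral E t x)
      = (\<Sum>b\<in>range h. (fst b * snd b) *\<^sub>R E (h -` {b}) x)"
    unfolding s[of "simple_integral E t x"] by simp
  also have "\<dots> = simple_integral E (\<lambda>r. s r * t r) x"
    using simple_integral_factor[OF h, of "\<lambda>b. fst b * snd b"] by (simp add: h_def)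
  finally show ?thesis .
qed

lemma simple_integral_symmetric:
  assumes "simple_function borel s"
  shows "cinner (simple_integral E s x) y = cinner x (simple_integral E s y)"
  using simple_function_borelD[OF assms]
  by (simp add: simple_integral_def cinner_sum_left cinner_sum_right cinner_scaleR_left
      cinner_scaleR_right projection_symmetric)

lemma sets_scalar_measure [measurable_cong]: "sets (scalar_measure E x) = sets borel"
  unfolding scalar_measure_def using sets.sigma_sets_eq[of "borel :: real measure"]
  by (simp add: sets_measure_of_conv)

lemma space_scalar_measure: "space (scalar_measure E x) = UNIV"
  by (simp add: scalar_measure_def space_measure_of_conv)

lemma emeasure_scalar_measure:
  assumes "B \<in> sets borel"
  shows "emeasure (scalar_measure E x) B = ennreal ((norm (E B x))\<^sup>2)"
proof -
  define \<mu> where "\<mu> = (\<lambda>B. ennreal (Re (cinner (E B x) x)))"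
  have "emeasure (measure_of UNIV (sets borel) \<mu>) B = \<mu> B"
  proof (rule emeasure_measure_of_sigma)
    show "sigma_algebra UNIV (sets (borel :: real measure))"
      using sets.sigma_algebra_axioms[of "borel :: real measure"] by simp
    show "positive (sets borel) \<mu>"
      by (simp add: positive_def \<mu>_def projection_empty cinner_form.form_zero_left)
    show "countably_additive (sets borel) \<mu>"
    proof (rule countably_additiveI)
      fix A :: "nat \<Rightarrow> real set"
      assume A: "range A \<subseteq> sets borel" "disjoint_family A" "\<Union> (range A) \<in> sets borel"
      have sums: "(\<lambda>n. Re (cinner (E (A n) x) x)) sums Re (cinner (E (\<Union>n. A n) x) x)"
        by (intro bounded_linear.sums[OF bounded_linear_Re_cinner] projection_sums A)
      have "(\<Sum>n. \<mu> (A n)) = ennreal (\<Sum>n. Re (cinner (E (A n) x) x))"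
        unfolding \<mu>_def
      proof (rule suminf_ennreal2)
        show "0 \<le> Re (cinner (E (A n) x) x)" for n
          using A by (simp add: cinner_projection_self image_subset_iff)
        show "summable (\<lambda>n. Re (cinner (E (A n) x) x))"
          using sums by (rule sums_summable)
      qed
      also have "\<dots> = \<mu> (\<Union> (range A))"
        using sums by (simp add: \<mu>_def sums_iff)
      finally show "(\<Sum>n. \<mu> (A n)) = \<mu> (\<Union> (range A))" .
    qed
  qed (rule assms)
  moreover have "scalar_measure E x = measure_of UNIV (sets borel) \<mu>"
    by (simp add: scalar_measure_def \<mu>_def)
  ultimately show ?thesis
    using assms by (simp add: \<mu>_def cinner_projection_self)
qed

text \<open>The isometry that turns \<open>L\<^sup>2\<close> convergence of simple functions into norm convergence of their
  integrals.\<close>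

lemma norm_simple_integral:
  assumes s: "simple_function borel s"
  shows "ennreal ((norm (simple_integral E s x))\<^sup>2)
    = (\<integral>\<^sup>+ t. ennreal ((s t)\<^sup>2) \<partial>scalar_measure E x)"
proof -
  note fin = simple_function_borelD(1)[OF s] and meas = simple_function_borelD(2)[OF s]
  have "cinner (simple_integral E s x) (simple_integral E s x)
      = cinner (simple_integral E (\<lambda>t. s t * s t) x) x"
    using s by (simp add: simple_integral_symmetric[symmetric] simple_integral_mult)
  also have "\<dots> = (\<Sum>c\<in>range s. of_real (c * c) * cinner (E (s -` {c}) x) x)"
    using simple_integral_factor[OF s, of "\<lambda>c. c * c"]
    by (simp add: cinner_sum_left cinner_scaleR_left)
  finally have "(norm (simple_integral E s x))\<^sup>2 = (\<Sum>c\<in>range s. c\<^sup>2 * (norm (E (s -` {c}) x))\<^sup>2)"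
    unfolding norm_square_cinner[of "simple_integral E s x"]
    using meas by (simp add: cinner_projection_self power2_eq_square[of "_ :: real"])
  then have "ennreal ((norm (simple_integral E s x))\<^sup>2)
      = (\<Sum>c\<in>range s. ennreal (c\<^sup>2) * emeasure (scalar_measure E x) (s -` {c}))"
    using meas by (simp add: emeasure_scalar_measure ennreal_mult sum_ennreal[symmetric])
  also have "\<dots> = (\<Sum>c\<in>range s. \<integral>\<^sup>+ t. ennreal (c\<^sup>2) * indicator (s -` {c}) t \<partial>scalar_measure E x)"
    using meas by (simp add: nn_integral_cmult_indicator sets_scalar_measure)
  also have "\<dots> = (\<integral>\<^sup>+ t. (\<Sum>c\<in>range s. ennreal (c\<^sup>2) * indicator (s -` {c}) t) \<partial>scalar_measure E x)"
    using borel_measurable_simple_function[OF s]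
    by (intro nn_integral_sum[symmetric]) measurable
  also have "\<dots> = (\<integral>\<^sup>+ t. ennreal ((s t)\<^sup>2) \<partial>scalar_measure E x)"
  proof (rule nn_integral_cong)
    fix t
    have "(\<Sum>c\<in>range s. ennreal (c\<^sup>2) * indicator (s -` {c}) t)
        = (\<Sum>c\<in>range s. if c = s t then ennreal ((s t)\<^sup>2) else 0)"
      by (intro sum.cong) (auto simp: indicator_def)
    then show "(\<Sum>c\<in>range s. ennreal (c\<^sup>2) * indicator (s -` {c}) t) = ennreal ((s t)\<^sup>2)"
      using fin by simp
  qed
  finally show ?thesis .
qed

definition L2_distance :: "'a \<Rightarrow> (real \<Rightarrow> real) \<Rightarrow> (real \<Rightarrow> real) \<Rightarrow> ennreal" where
  "L2_distance x s \<phi> = (\<integral>\<^sup>+ t. ennreal ((s t - \<phi> t)\<^sup>2) \<partial>scalar_measure E x)"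

lemma norm_simple_integral_diff_le:
  assumes s: "simple_function borel s" and s': "simple_function borel s'"
    and \<phi> [measurable]: "\<phi> \<in> borel_measurable borel"
  shows "ennreal ((norm (simple_integral E s x - simple_integral E s' x))\<^sup>2)
    \<le> 2 * L2_distance x s \<phi> + 2 * L2_distance x s' \<phi>"
proof -
  note [measurable] = borel_measurable_simple_function[OF s] borel_measurable_simple_function[OF s']
  have "ennreal ((norm (simple_integral E s x - simple_integral E s' x))\<^sup>2)
      = (\<integral>\<^sup>+ t. ennreal ((s t - s' t)\<^sup>2) \<partial>scalar_measure E x)"
    using norm_simple_integral[of "\<lambda>t. s t - s' t" x] s s' by (simp add: simple_integral_diff)
  also have "\<dots> \<le> (\<integral>\<^sup>+ t. 2 * ennreal ((s t - \<phi> t)\<^sup>2) + 2 * ennreal ((s' t - \<phi> t)\<^sup>2) \<partial>scalar_measure E x)"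
  proof (rule nn_integral_mono)
    fix t
    have "(s t - s' t)\<^sup>2 \<le> 2 * (s t - \<phi> t)\<^sup>2 + 2 * (s' t - \<phi> t)\<^sup>2"
      using sum_squares_ge_zero[of "(s t - \<phi> t) + (s' t - \<phi> t)" 0]
      by (simp add: power2_eq_square algebra_simps)
    then have "ennreal ((s t - s' t)\<^sup>2) \<le> ennreal (2 * (s t - \<phi> t)\<^sup>2 + 2 * (s' t - \<phi> t)\<^sup>2)"
      by (rule ennreal_leI)
    then show "ennreal ((s t - s' t)\<^sup>2)
        \<le> 2 * ennreal ((s t - \<phi> t)\<^sup>2) + 2 * ennreal ((s' t - \<phi> t)\<^sup>2)"
      by (simp add: ennreal_plus ennreal_mult)
  qed
  also have "\<dots> = 2 * L2_distance x s \<phi> + 2 * L2_distance x s' \<phi>"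
    unfolding L2_distance_def by (simp add: nn_integral_add nn_integral_cmult)
  finally show ?thesis .
qed

lemma simple_integral_Cauchy:
  assumes "\<And>n. simple_function borel (s n)" "\<phi> \<in> borel_measurable borel"
    and lim: "(\<lambda>n. L2_distance x (s n) \<phi>) \<longlonglongrightarrow> 0"
  shows "Cauchy (\<lambda>n. simple_integral E (s n) x)"
proof (rule metric_CauchyI)
  fix \<epsilon> :: real
  assume "\<epsilon> > 0"
  then have "ennreal (\<epsilon>\<^sup>2 / 4) > 0"
    by simp
  then have "eventually (\<lambda>n. L2_distance x (s n) \<phi> < ennreal (\<epsilon>\<^sup>2 / 4)) sequentially"
    using lim by (rule order_tendstoD(2)[rotated])
  then obtain N where N: "\<And>n. n \<ge> N \<Longrightarrow> L2_distance x (s n) \<phi> < ennreal (\<epsilon>\<^sup>2 / 4)"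
    by (auto simp: eventually_sequentially)
  have "dist (simple_integral E (s m) x) (simple_integral E (s n) x) < \<epsilon>" if "m \<ge> N" "n \<ge> N" for m n
  proof -
    have "ennreal ((norm (simple_integral E (s m) x - simple_integral E (s n) x))\<^sup>2)
        \<le> 2 * L2_distance x (s m) \<phi> + 2 * L2_distance x (s n) \<phi>"
      using assms by (intro norm_simple_integral_diff_le)
    also have "\<dots> < 2 * ennreal (\<epsilon>\<^sup>2 / 4) + 2 * ennreal (\<epsilon>\<^sup>2 / 4)"
      using N that by (intro add_strict_mono ennreal_mult_strict_left_mono) auto
    also have "\<dots> = 4 * ennreal (\<epsilon>\<^sup>2 / 4)"
      using distrib_right[of 2 2 "ennreal (\<epsilon>\<^sup>2 / 4)"] by simp
    also have "\<dots> = ennreal (\<epsilon>\<^sup>2)"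
      using ennreal_mult[of 4 "\<epsilon>\<^sup>2 / 4"] by simp
    finally have "(norm (simple_integral E (s m) x - simple_integral E (s n) x))\<^sup>2 < \<epsilon>\<^sup>2"
      by (simp add: ennreal_less_iff)
    then show ?thesis
      using \<open>\<epsilon> > 0\<close> by (simp add: dist_norm power2_less_imp_less)
  qed
  then show "\<exists>N. \<forall>m\<ge>N. \<forall>n\<ge>N. dist (simple_integral E (s m) x) (simple_integral E (s n) x) < \<epsilon>"
    by blast
qed

text \<open>This makes the description in the spectral integral definite: the limit does not depend on the
  approximating sequence.\<close>

lemma simple_integral_limit_unique:
  assumes "\<And>n. simple_function borel (s n)" "\<And>n. simple_function borel (s' n)"
    and "\<phi> \<in> borel_measurable borel"
    and lim: "(\<lambda>n. L2_distance x (s n) \<phi>) \<longlonglongrightarrow> 0" "(\<lambda>n. L2_distance x (s' n) \<phi>) \<longlonglongrightarrow> 0"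
    and z: "(\<lambda>n. simple_integral E (s n) x) \<longlonglongrightarrow> z" "(\<lambda>n. simple_integral E (s' n) x) \<longlonglongrightarrow> z'"
  shows "z = z'"
proof -
  have bound: "(\<lambda>n. 2 * L2_distance x (s n) \<phi> + 2 * L2_distance x (s' n) \<phi>) \<longlonglongrightarrow> 2 * 0 + 2 * 0"
    using lim by (intro tendsto_add tendsto_mult_ennreal tendsto_const) auto
  have "(\<lambda>n. ennreal ((norm (simple_integral E (s n) x - simple_integral E (s' n) x))\<^sup>2)) \<longlonglongrightarrow> 0"
  proof (rule tendsto_sandwich[OF _ _ tendsto_const])
    show "(\<lambda>n. 2 * L2_distance x (s n) \<phi> + 2 * L2_distance x (s' n) \<phi>) \<longlonglongrightarrow> 0"
      using bound by simp
  qed (use assms norm_simple_integral_diff_le in auto)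
  moreover have "(\<lambda>n. ennreal ((norm (simple_integral E (s n) x - simple_integral E (s' n) x))\<^sup>2))
      \<longlonglongrightarrow> ennreal ((norm (z - z'))\<^sup>2)"
    by (intro tendsto_ennrealI tendsto_intros z)
  ultimately have "ennreal ((norm (z - z'))\<^sup>2) = 0"
    by (rule LIMSEQ_unique[rotated])
  then show ?thesis
    by simp
qed

text \<open>By dominated convergence \<open>s n\<close> tends to \<open>\<phi>\<close> in \<open>L\<^sup>2\<close> of every scalar measure of an \<open>x\<close> in the domain.
  So one sequence serves all \<open>x\<close>, and its powers serve the powers of \<open>\<phi>\<close>.\<close>

lemma spectral_integral_tendsto:
  assumes x: "x \<in> dom (spectral_integral E \<phi>)"
    and \<phi> [measurable]: "\<phi> \<in> borel_measurable borel"
    and s: "\<And>n. simple_function borel (s n)"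
    and dominated: "\<And>n t. \<bar>s n t\<bar> \<le> K * \<bar>\<phi> t\<bar>"
    and pointwise: "\<And>t. (\<lambda>n. s n t) \<longlonglongrightarrow> \<phi> t"
  shows "(\<lambda>n. simple_integral E (s n) x) \<longlonglongrightarrow> spectral_integral E \<phi> \<cdot> x"
proof -
  note [measurable] = borel_measurable_simple_function[OF s]
  have fin: "(\<integral>\<^sup>+ t. ennreal ((\<phi> t)\<^sup>2) \<partial>scalar_measure E x) < \<infinity>"
    using x by (auto simp: spectral_integral_def split: if_splits)
  have "(\<lambda>n. L2_distance x (s n) \<phi>) \<longlonglongrightarrow> (\<integral>\<^sup>+ t. 0 \<partial>scalar_measure E x)"
    unfolding L2_distance_def
  proof (rule nn_integral_dominated_convergence)
    show "AE t in scalar_measure E x.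
        ennreal ((s n t - \<phi> t)\<^sup>2) \<le> ennreal ((K + 1)\<^sup>2) * ennreal ((\<phi> t)\<^sup>2)" for n
    proof (rule AE_I2)
      fix t
      have "\<bar>s n t - \<phi> t\<bar> \<le> (K + 1) * \<bar>\<phi> t\<bar>"
        using dominated[of n t] by (simp add: algebra_simps)
      then have "(s n t - \<phi> t)\<^sup>2 \<le> ((K + 1) * \<bar>\<phi> t\<bar>)\<^sup>2"
        by (metis abs_ge_zero power2_abs power_mono)
      then show "ennreal ((s n t - \<phi> t)\<^sup>2) \<le> ennreal ((K + 1)\<^sup>2) * ennreal ((\<phi> t)\<^sup>2)"
        by (simp add: ennreal_mult[symmetric] power_mult_distrib ennreal_leI)
    qed
    show "(\<integral>\<^sup>+ t. ennreal ((K + 1)\<^sup>2) * ennreal ((\<phi> t)\<^sup>2) \<partial>scalar_measure E x) < \<infinity>"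
      using fin by (simp add: nn_integral_cmult ennreal_mult_less_top)
    show "AE t in scalar_measure E x. (\<lambda>n. ennreal ((s n t - \<phi> t)\<^sup>2)) \<longlonglongrightarrow> 0"
    proof (rule AE_I2)
      fix t
      have "(\<lambda>n. ennreal ((s n t - \<phi> t)\<^sup>2)) \<longlonglongrightarrow> ennreal ((\<phi> t - \<phi> t)\<^sup>2)"
        by (intro tendsto_ennrealI tendsto_intros pointwise)
      then show "(\<lambda>n. ennreal ((s n t - \<phi> t)\<^sup>2)) \<longlonglongrightarrow> 0"
        by simp
    qed
  qed measurable
  then have L2: "(\<lambda>n. L2_distance x (s n) \<phi>) \<longlonglongrightarrow> 0"
    by simp
  then obtain z where z: "(\<lambda>n. simple_integral E (s n) x) \<longlonglongrightarrow> z"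
    using Cauchy_convergent[OF simple_integral_Cauchy[OF s \<phi> L2]] by (auto simp: convergent_def)
  have "spectral_integral E \<phi> x = Some (THE z. \<exists>s. (\<forall>n. simple_function borel (s n)) \<and>
      (\<lambda>n. L2_distance x (s n) \<phi>) \<longlonglongrightarrow> 0 \<and> (\<lambda>n. simple_integral E (s n) x) \<longlonglongrightarrow> z)"
    using fin by (simp add: spectral_integral_def L2_distance_def)
  also have "\<dots> = Some z"
    unfolding option.inject
  proof (rule the_equality)
    show "\<exists>s. (\<forall>n. simple_function borel (s n)) \<and>
        (\<lambda>n. L2_distance x (s n) \<phi>) \<longlonglongrightarrow> 0 \<and> (\<lambda>n. simple_integral E (s n) x) \<longlonglongrightarrow> z"
      using s L2 z by blast
  next
    fix z'
    assume "\<exists>s. (\<forall>n. simple_function borel (s n)) \<and>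
        (\<lambda>n. L2_distance x (s n) \<phi>) \<longlonglongrightarrow> 0 \<and> (\<lambda>n. simple_integral E (s n) x) \<longlonglongrightarrow> z'"
    then show "z' = z"
      using simple_integral_limit_unique[OF _ s \<phi> _ L2 _ z] by blast
  qed
  finally show ?thesis
    using z by (simp add: app_def)
qed

text \<open>The scalar measures are finite and \<open>\<phi>\<^sup>2 \<le> 1 + \<phi>\<^sup>4\<close>.\<close>

lemma dom_spectral_integral_square:
  assumes \<phi> [measurable]: "\<phi> \<in> borel_measurable borel"
    and x: "x \<in> dom (spectral_integral E (\<lambda>t. (\<phi> t)\<^sup>2))"
  shows "x \<in> dom (spectral_integral E \<phi>)"
proof -
  have fin: "(\<integral>\<^sup>+ t. ennreal (((\<phi> t)\<^sup>2)\<^sup>2) \<partial>scalar_measure E x) < \<infinity>"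
    using x by (auto simp: spectral_integral_def split: if_splits)
  have "(\<integral>\<^sup>+ t. ennreal ((\<phi> t)\<^sup>2) \<partial>scalar_measure E x)
      \<le> (\<integral>\<^sup>+ t. 1 + ennreal (((\<phi> t)\<^sup>2)\<^sup>2) \<partial>scalar_measure E x)"
  proof (rule nn_integral_mono)
    fix t
    have "y \<le> 1 + y\<^sup>2" for y :: real
      using sum_squares_ge_zero[of "y - 1/2" 0] by (simp add: power2_eq_square algebra_simps)
    then have "ennreal ((\<phi> t)\<^sup>2) \<le> ennreal (1 + ((\<phi> t)\<^sup>2)\<^sup>2)"
      by (rule ennreal_leI)
    then show "ennreal ((\<phi> t)\<^sup>2) \<le> 1 + ennreal (((\<phi> t)\<^sup>2)\<^sup>2)"
      by (simp add: ennreal_plus)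
  qed
  also have "\<dots> = emeasure (scalar_measure E x) UNIV
      + (\<integral>\<^sup>+ t. ennreal (((\<phi> t)\<^sup>2)\<^sup>2) \<partial>scalar_measure E x)"
    by (simp add: nn_integral_add space_scalar_measure)
  also have "\<dots> < \<infinity>"
    using fin by (simp add: emeasure_scalar_measure)
  finally show ?thesis
    by (simp add: spectral_integral_def dom_def)
qed

text \<open>Formally \<open>G = R\<^sup>2\<close>. The first identity then moves one factor \<open>R\<close> across the inner product, and
  the inequality is Cauchy-Schwarz for the form \<open>(R y, z)\<close> at \<open>y = x\<close> and \<open>z = R x\<close>. Both are checked on
  the bounded operators given by simple functions \<open>u n \<longlonglongrightarrow> \<upsilon>\<close> and their powers, where products can be
  formed freely and where Cauchy-Schwarz for the form of \<open>(u n)\<^sup>2\<close> reduces to that of the Hilbert space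
  by moving one factor \<open>u n\<close> to the other side.\<close>

lemma spectral_integral_square_root:
  fixes \<upsilon> :: "real \<Rightarrow> real"
  defines "R \<equiv> spectral_integral E (\<lambda>t. (\<upsilon> t)\<^sup>2)"
    and "G \<equiv> spectral_integral E (\<lambda>t. ((\<upsilon> t)\<^sup>2)\<^sup>2)"
  assumes \<upsilon> [measurable]: "\<upsilon> \<in> borel_measurable borel"
    and x: "x \<in> dom G"
  shows "y \<in> dom G \<Longrightarrow> cinner (G \<cdot> x) (R \<cdot> y) = cinner (R \<cdot> x) (G \<cdot> y)"
    and "(norm (R \<cdot> x)) ^ 4 \<le> Re (cinner (R \<cdot> x) x) * Re (cinner (G \<cdot> x) (R \<cdot> x))"
    and "cinner x (R \<cdot> x) = cinner (R \<cdot> x) x"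
proof -
  obtain u where u: "\<And>n. simple_function borel (u n)" "\<And>t. (\<lambda>n. u n t) \<longlonglongrightarrow> \<upsilon> t"
      "\<And>n t. dist (u n t) 0 \<le> 2 * dist (\<upsilon> t) 0"
    using borel_measurable_implies_sequence_metric[OF \<upsilon>, of 0] by auto
  define U where "U n = simple_integral E (u n)" for n
  define T where "T n = simple_integral E (\<lambda>t. (u n t)\<^sup>2)" for n
  define S where "S n = simple_integral E (\<lambda>t. ((u n t)\<^sup>2)\<^sup>2)" for n
  have u2: "simple_function borel (\<lambda>t. (u n t)\<^sup>2)" for n
    using u(1)[of n] by (simp add: power2_eq_square)
  have u4: "simple_function borel (\<lambda>t. ((u n t)\<^sup>2)\<^sup>2)" for n
    using u2[of n] by (simp add: power2_eq_square)
  have UU: "U n (U n z) = T n z" for n z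
    using simple_integral_mult[OF u(1) u(1)] by (simp add: U_def T_def power2_eq_square)
  have TT: "T n (T n z) = S n z" for n z
    using simple_integral_mult[OF u2 u2] by (simp add: T_def S_def power2_eq_square)
  have symU: "cinner (U n z) w = cinner z (U n w)" for n z w
    unfolding U_def by (rule simple_integral_symmetric[OF u(1)])
  have symT: "cinner (T n z) w = cinner z (T n w)" for n z w
    unfolding T_def by (rule simple_integral_symmetric[OF u2])
  have bound2: "(u n t)\<^sup>2 \<le> 4 * (\<upsilon> t)\<^sup>2" for n t
    using power_mono[of "\<bar>u n t\<bar>" "2 * \<bar>\<upsilon> t\<bar>" 2] u(3)[of n t] by (simp add: power_mult_distrib)
  have bound4: "((u n t)\<^sup>2)\<^sup>2 \<le> 16 * ((\<upsilon> t)\<^sup>2)\<^sup>2" for n t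
    using power_mono[OF bound2[of n t], of 2] by (simp add: power_mult_distrib)
  have S: "(\<lambda>n. S n z) \<longlonglongrightarrow> G \<cdot> z" if "z \<in> dom G" for z
    unfolding S_def G_def
    by (rule spectral_integral_tendsto[where K = 16])
      (use that u4 bound4 u(2) in \<open>auto simp: G_def intro!: tendsto_intros\<close>)
  have T: "(\<lambda>n. T n z) \<longlonglongrightarrow> R \<cdot> z" if "z \<in> dom G" for z
    unfolding T_def R_def
  proof (rule spectral_integral_tendsto[where K = 4])
    show "z \<in> dom (spectral_integral E (\<lambda>t. (\<upsilon> t)\<^sup>2))"
      using that unfolding G_def by (rule dom_spectral_integral_square[rotated]) measurable
  qed (use u2 bound2 u(2) in \<open>auto intro!: tendsto_intros\<close>)
  show "cinner (G \<cdot> x) (R \<cdot> y) = cinner (R \<cdot> x) (G \<cdot> y)" if y: "y \<in> dom G"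
  proof (rule LIMSEQ_unique)
    show "(\<lambda>n. cinner (S n x) (T n y)) \<longlonglongrightarrow> cinner (G \<cdot> x) (R \<cdot> y)"
      by (intro tendsto_cinner S T x y)
    have "(\<lambda>n. cinner (T n x) (S n y)) \<longlonglongrightarrow> cinner (R \<cdot> x) (G \<cdot> y)"
      by (intro tendsto_cinner S T x y)
    then show "(\<lambda>n. cinner (S n x) (T n y)) \<longlonglongrightarrow> cinner (R \<cdot> x) (G \<cdot> y)"
      by (simp add: TT[symmetric] symT)
  qed
  show "(norm (R \<cdot> x)) ^ 4 \<le> Re (cinner (R \<cdot> x) x) * Re (cinner (G \<cdot> x) (R \<cdot> x))"
  proof (rule LIMSEQ_le)
    show "(\<lambda>n. (norm (T n x)) ^ 4) \<longlonglongrightarrow> (norm (R \<cdot> x)) ^ 4"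
      by (intro tendsto_intros T x)
    show "(\<lambda>n. Re (cinner (T n x) x) * Re (cinner (S n x) (T n x)))
        \<longlonglongrightarrow> Re (cinner (R \<cdot> x) x) * Re (cinner (G \<cdot> x) (R \<cdot> x))"
      by (intro tendsto_mult tendsto_Re tendsto_cinner S T x tendsto_const)
    have "(norm (T n x)) ^ 4 \<le> Re (cinner (T n x) x) * Re (cinner (S n x) (T n x))" for n
    proof -
      have "(norm (T n x))\<^sup>2 = Re (cinner (U n x) (U n (T n x)))"
        by (simp add: norm_square_cinner symU[symmetric] UU)
      also have "\<dots> \<le> norm (U n x) * norm (U n (T n x))"
        using cinner_Cauchy_Schwarz complex_Re_le_cmod order_trans by blast
      finally have "((norm (T n x))\<^sup>2)\<^sup>2 \<le> (norm (U n x) * norm (U n (T n x)))\<^sup>2"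
        by (intro power_mono) auto
      also have "\<dots> = Re (cinner (T n x) x) * Re (cinner (S n x) (T n x))"
        by (simp add: power_mult_distrib norm_square_cinner symU[symmetric] UU TT)
      finally show ?thesis
        by simp
    qed
    then show "\<exists>N. \<forall>n\<ge>N. (norm (T n x)) ^ 4 \<le> Re (cinner (T n x) x) * Re (cinner (S n x) (T n x))"
      by blast
  qed
  show "cinner x (R \<cdot> x) = cinner (R \<cdot> x) x"
  proof (rule LIMSEQ_unique)
    show "(\<lambda>n. cinner x (T n x)) \<longlonglongrightarrow> cinner x (R \<cdot> x)"
      by (intro tendsto_cinner T x tendsto_const)
    have "(\<lambda>n. cinner (T n x) x) \<longlonglongrightarrow> cinner (R \<cdot> x) x"
      by (intro tendsto_cinner T x tendsto_const)
    then show "(\<lambda>n. cinner x (T n x)) \<longlonglongrightarrow> cinner (R \<cdot> x) x"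
      by (simp add: symT)
  qed
qed

end


section \<open>Operators of \<open>\<C>\<close>-symmetry\<close>

lemma
  assumes "fundamental_symmetry J"
  shows fundamental_symmetry_add: "J (x + y) = J x + J y"
    and fundamental_symmetry_diff: "J (x - y) = J x - J y"
    and fundamental_symmetry_scaleC: "J (c *\<^sub>C x) = c *\<^sub>C J x"
    and fundamental_symmetry_cinner: "cinner (J x) y = cinner x (J y)"
    and fundamental_symmetry_involution: "J (J x) = x"
proof -
  have "linear J"
    using assms by (simp add: fundamental_symmetry_def bounded_linear.linear)
  then show "J (x + y) = J x + J y" "J (x - y) = J x - J y"
    by (simp_all add: linear_add linear_diff)
qed (use assms in \<open>simp_all add: fundamental_symmetry_def\<close>)

lemma indef_commute: "fundamental_symmetry J \<Longrightarrow> indef J x y = cnj (indef J y x)"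
  using cinner_commute[of "J x" y] by (simp add: indef_def fundamental_symmetry_cinner)

lemma H_plus_eigenvector: "fundamental_symmetry J \<Longrightarrow> x \<in> H_plus J \<Longrightarrow> J x = x"
  by (auto simp: H_plus_def fundamental_symmetry_add fundamental_symmetry_scaleC
      fundamental_symmetry_involution add.commute)

lemma H_minus_eigenvector: "fundamental_symmetry J \<Longrightarrow> x \<in> H_minus J \<Longrightarrow> J x = - x"
  by (auto simp: H_minus_def fundamental_symmetry_diff fundamental_symmetry_scaleC
      fundamental_symmetry_involution complex_vector.scale_right_diff_distrib)

lemma dom_lmult: "dom (lmult J A) = dom A"
  by (auto simp: lmult_def)

lemma app_lmult: "x \<in> dom A \<Longrightarrow> lmult J A \<cdot> x = J (A \<cdot> x)"
  by (auto simp: lmult_def app_def)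

lemma lmult_involution: "fundamental_symmetry J \<Longrightarrow> lmult J (lmult J A) = A"
  by (simp add: lmult_def option.map_comp comp_def fundamental_symmetry_involution option.map_ident)

locale dual_definite_pair =
  fixes J :: "'a::complex_hilbert_space \<Rightarrow> 'a" and Lp Lm :: "'a set"
  assumes J: "fundamental_symmetry J"
    and dual_definite: "dual_definite J Lp Lm"
begin

lemma subspace_Lp: "complex_vector.subspace Lp" and subspace_Lm: "complex_vector.subspace Lm"
  using dual_definite
  by (auto simp: dual_definite_def positive_subspace_def negative_subspace_def closed_subspace_def)

lemma indef_Lp_Lm: "x \<in> Lp \<Longrightarrow> y \<in> Lm \<Longrightarrow> indef J x y = 0"
  using dual_definite by (simp add: dual_definite_def)

lemma indef_Lm_Lp: "x \<in> Lm \<Longrightarrow> y \<in> Lp \<Longrightarrow> indef J x y = 0"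
  using indef_Lp_Lm[of y x] indef_commute[OF J, of x y] by simp

lemma indef_Lp_nonneg: "x \<in> Lp \<Longrightarrow> 0 \<le> Re (indef J x x)"
  and indef_Lm_nonpos: "x \<in> Lm \<Longrightarrow> Re (indef J x x) \<le> 0"
proof -
  have "indef J 0 0 = 0"
    by (simp add: indef_def cinner_commute[of _ 0] cinner_form.form_zero_left)
  then show "x \<in> Lp \<Longrightarrow> 0 \<le> Re (indef J x x)" "x \<in> Lm \<Longrightarrow> Re (indef J x x) \<le> 0"
    using dual_definite unfolding dual_definite_def positive_subspace_def negative_subspace_def
    by (cases "x = 0"; fastforce)+
qed

lemma decomposition_unique:
  assumes "x \<in> Lp" "x' \<in> Lp" "y \<in> Lm" "y' \<in> Lm" "x + y = x' + y'"
  shows "x = x'" "y = y'"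
proof -
  have eq: "x - x' = y' - y"
    using assms(5) by (simp add: algebra_simps)
  have "x - x' \<in> Lp"
    using assms by (intro complex_vector.subspace_diff[OF subspace_Lp])
  moreover have "x - x' \<in> Lm"
    unfolding eq using assms by (intro complex_vector.subspace_diff[OF subspace_Lm])
  ultimately have "x - x' = 0"
    using dual_definite
    unfolding dual_definite_def positive_subspace_def negative_subspace_def by fastforce
  then show "x = x'" "y = y'"
    using assms(5) by auto
qed

lemma C_zero_sum:
  assumes "x \<in> Lp" "y \<in> Lm"
  shows "C_zero Lp Lm (x + y) = Some (x - y)"
proof -
  have "(THE w. \<exists>x'\<in>Lp. \<exists>y'\<in>Lm. x + y = x' + y' \<and> w = x' - y') = x - y"
    using assms decomposition_unique by (intro the_equality) blast+
  then show ?thesis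
    using assms by (auto simp: C_zero_def subspace_sum_def)
qed

lemma app_C_zero: "x \<in> Lp \<Longrightarrow> y \<in> Lm \<Longrightarrow> C_zero Lp Lm \<cdot> (x + y) = x - y"
  by (simp add: app_def C_zero_sum)

lemma C_zero_Lp: "x \<in> Lp \<Longrightarrow> C_zero Lp Lm x = Some x"
  using C_zero_sum[of x 0] by (simp add: complex_vector.subspace_0[OF subspace_Lm])

lemma C_zero_Lm: "x \<in> Lm \<Longrightarrow> C_zero Lp Lm x = Some (- x)"
  using C_zero_sum[of 0 x] by (simp add: complex_vector.subspace_0[OF subspace_Lp])

lemma dom_C_zeroE:
  assumes "v \<in> dom (C_zero Lp Lm)"
  obtains x y where "v = x + y" "x \<in> Lp" "y \<in> Lm"
  using assms by (auto simp: C_zero_def subspace_sum_def split: if_splits)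

lemma mem_dom_C_zero: "x \<in> Lp \<Longrightarrow> y \<in> Lm \<Longrightarrow> x + y \<in> dom (C_zero Lp Lm)"
  by (simp add: C_zero_sum domI)

lemma C_zero_involution:
  assumes "v \<in> dom (C_zero Lp Lm)"
  shows "C_zero Lp Lm \<cdot> v \<in> dom (C_zero Lp Lm)" "C_zero Lp Lm \<cdot> (C_zero Lp Lm \<cdot> v) = v"
proof -
  obtain x y where v: "v = x + y" "x \<in> Lp" "y \<in> Lm"
    using assms by (rule dom_C_zeroE)
  moreover have "- y \<in> Lm"
    using v complex_vector.subspace_neg[OF subspace_Lm] by blast
  ultimately show "C_zero Lp Lm \<cdot> v \<in> dom (C_zero Lp Lm)" "C_zero Lp Lm \<cdot> (C_zero Lp Lm \<cdot> v) = v"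
    using mem_dom_C_zero[of x "- y"] app_C_zero[of x "- y"] by (simp_all add: app_C_zero)
qed

lemma G_form_C_zero:
  assumes "x \<in> Lp" "y \<in> Lm" "x' \<in> Lp" "y' \<in> Lm"
  shows "G_form (lmult J (C_zero Lp Lm)) (x + y) (x' + y') = indef J x x' - indef J y y'"
proof -
  have "G_form (lmult J (C_zero Lp Lm)) (x + y) (x' + y') = indef J (x - y) (x' + y')"
    using assms by (simp add: G_form_def app_lmult mem_dom_C_zero app_C_zero indef_def)
  also have "\<dots> = indef J x x' + indef J x y' - indef J y x' - indef J y y'"
    by (simp add: indef_def fundamental_symmetry_diff[OF J] cinner_diff_left cinner_add_right)
  finally show ?thesis
    using assms by (simp add: indef_Lp_Lm indef_Lm_Lp)
qed

text \<open>Changing the sign of the indefinite form on the negative subspace makes it positive.\<close>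

lemma hermitian_form_C_zero:
  "hermitian_form (dom (C_zero Lp Lm)) (G_form (lmult J (C_zero Lp Lm)))"
proof
  let ?D = "dom (C_zero Lp Lm)" and ?B = "G_form (lmult J (C_zero Lp Lm))"
  note Lp_closed = complex_vector.subspace_add[OF subspace_Lp] complex_vector.subspace_scale[OF subspace_Lp]
    and Lm_closed = complex_vector.subspace_add[OF subspace_Lm] complex_vector.subspace_scale[OF subspace_Lm]
  show "complex_vector.subspace ?D"
  proof (rule complex_vector.subspaceI)
    show "0 \<in> ?D"
      using mem_dom_C_zero[of 0 0] complex_vector.subspace_0[OF subspace_Lp]
        complex_vector.subspace_0[OF subspace_Lm] by simp
  next
    fix v w
    assume "v \<in> ?D" "w \<in> ?D"
    then obtain x y x' y' where v: "v = x + y" "x \<in> Lp" "y \<in> Lm" "w = x' + y'" "x' \<in> Lp" "y' \<in> Lm"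
      by (auto elim!: dom_C_zeroE)
    then have "(x + x') + (y + y') \<in> ?D"
      by (intro mem_dom_C_zero Lp_closed Lm_closed)
    then show "v + w \<in> ?D"
      by (simp add: v add.assoc add.left_commute)
  next
    fix c v
    assume "v \<in> ?D"
    then obtain x y where v: "v = x + y" "x \<in> Lp" "y \<in> Lm"
      by (auto elim!: dom_C_zeroE)
    then have "c *\<^sub>C x + c *\<^sub>C y \<in> ?D"
      by (intro mem_dom_C_zero Lp_closed Lm_closed)
    then show "c *\<^sub>C v \<in> ?D"
      by (simp add: v scaleC_add_right)
  qed
  fix v w
  assume vw: "v \<in> ?D" "w \<in> ?D"
  from vw(1) obtain x y where v: "v = x + y" "x \<in> Lp" "y \<in> Lm" by (rule dom_C_zeroE)
  from vw(2) obtain x' y' where w: "w = x' + y'" "x' \<in> Lp" "y' \<in> Lm" by (rule dom_C_zeroE)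
  show "?B v w = cnj (?B w v)"
    using v w indef_commute[OF J, of x x'] indef_commute[OF J, of y y'] by (simp add: G_form_C_zero)
  show "0 \<le> Re (?B v v)"
    using v indef_Lp_nonneg[of x] indef_Lm_nonpos[of y] by (simp add: G_form_C_zero)
  show "?B (c *\<^sub>C v) w = c * ?B v w" for c
  proof -
    have "c *\<^sub>C v = c *\<^sub>C x + c *\<^sub>C y"
      by (simp add: v scaleC_add_right)
    then have "?B (c *\<^sub>C v) w = indef J (c *\<^sub>C x) x' - indef J (c *\<^sub>C y) y'"
      using v w by (simp add: G_form_C_zero Lp_closed Lm_closed)
    also have "\<dots> = c * ?B v w"
      using v w by (simp add: G_form_C_zero indef_def fundamental_symmetry_scaleC[OF J]
          cinner_scaleC_left right_diff_distrib)
    finally show ?thesis .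
  qed
  fix z
  assume z: "z \<in> ?D"
  then obtain x'' y'' where z: "z = x'' + y''" "x'' \<in> Lp" "y'' \<in> Lm" by (rule dom_C_zeroE)
  have "v + w = (x + x') + (y + y')"
    by (simp add: v w)
  then have "?B (v + w) z = ?B ((x + x') + (y + y')) (x'' + y'')"
    by (simp only: z)
  also have "\<dots> = indef J (x + x') x'' - indef J (y + y') y''"
    using v w z by (intro G_form_C_zero Lp_closed Lm_closed)
  also have "\<dots> = ?B v z + ?B w z"
    using v w z by (simp add: G_form_C_zero indef_def fundamental_symmetry_add[OF J] cinner_add_left)
  finally show "?B (v + w) z = ?B v z + ?B w z" .
qed

end

text \<open>The number \<open>[f n, f n]\<close> is real and of modulus one, so \<open>f n\<close> is a generator of one of the two
  subspaces; \<open>s\<close> is this number.\<close>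

lemma C_zero_J_orthonormal:
  assumes J: "fundamental_symmetry J"
    and f: "complete_J_orthonormal J f"
    and L: "dual_definite J (L_plus J f) (L_minus J f)"
  obtains s :: real where "s = 1 \<or> s = -1"
    "C_zero (L_plus J f) (L_minus J f) (f n) = Some (of_real s *\<^sub>C f n)"
proof -
  interpret dual_definite_pair J "L_plus J f" "L_minus J f"
    using J L by unfold_locales
  define a where "a = indef J (f n) (f n)"
  have "a = cnj a"
    unfolding a_def by (rule indef_commute[OF J])
  then have real: "a = of_real (Re a)"
    by (simp add: complex_eq_iff)
  have "cmod a = 1"
    using f by (simp add: complete_J_orthonormal_def a_def)
  then have "\<bar>Re a\<bar> = 1"
    using real by (metis norm_of_real)
  then consider "a = 1" | "a = -1"
    using real by (metis abs_eq_iff' abs_one of_real_1 of_real_minus)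
  then show ?thesis
  proof cases
    case 1
    then have "f n \<in> L_plus J f"
      unfolding L_plus_def a_def
      by (intro closure_subset[THEN subsetD] complex_vector.span_base) blast
    then show ?thesis
      using that[of 1] by (simp add: C_zero_Lp scaleC_one)
  next
    case 2
    then have "f n \<in> L_minus J f"
      unfolding L_minus_def a_def
      by (intro closure_subset[THEN subsetD] complex_vector.span_base) blast
    then show ?thesis
      using that[of "-1"] by (simp add: C_zero_Lm scaleC_one complex_vector.scale_minus_left)
  qed
qed


section \<open>The two expansions\<close>

theorem corollary6p5:
  fixes J :: "'a::complex_hilbert_space \<Rightarrow> 'a"
    and f :: "nat \<Rightarrow> 'a"
    and C Q :: "'a operator"
  defines "G \<equiv> lmult J C"
    and "R \<equiv> fun_calc (\<lambda>t. exp (t / 2)) Q"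
  assumes "fundamental_symmetry J"
    and "quasi_basis J f"
    and "C_symmetry J C"
    and "selfadjoint Q"
    and "lmult J Q = lmult uminus (rmult Q J)"
    and "C = lmult J (fun_calc exp Q)"
    and "C_zero (L_plus J f) (L_minus J f) \<subseteq>\<^sub>m C"
    and "Orthonormal_Basis (H_G G) (\<lambda>n. H_G_embed G (f n))"
    and "orthonormal_basis (\<lambda>n. R \<cdot> f n)"
    and "\<And>n. R \<cdot> f n \<in> H_plus J \<or> R \<cdot> f n \<in> H_minus J"
  shows "\<forall>g\<in>dom C.
    Sums (H_G G) (\<lambda>n. Scale (H_G G) (indef J g (f n)) (H_G_embed G (f n))) (H_G_embed G (C \<cdot> g)) \<and>
    (\<lambda>n. indef J (R \<cdot> g) (f n) *\<^sub>C (R \<cdot> f n)) sums (C \<cdot> g)"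
proof (intro ballI conjI)
  note J = assms(3)
  obtain Lp Lm where L: "dual_maximal_definite J Lp Lm" "C = C_zero Lp Lm"
    using assms(5) by (auto simp: C_symmetry_def)
  interpret C: dual_definite_pair J Lp Lm
    using J L by unfold_locales (simp_all add: dual_maximal_definite_def)
  interpret form: hermitian_form "dom G" "G_form G"
    using C.hermitian_form_C_zero by (simp add: G_def L dom_lmult)
  have dom_G: "dom G = dom C"
    by (simp add: G_def dom_lmult)
  have involution: "C \<cdot> v \<in> dom C" "C \<cdot> (C \<cdot> v) = v" if "v \<in> dom C" for v
    using C.C_zero_involution[of v] that L by auto
  have G_app: "G \<cdot> v = J (C \<cdot> v)" if "v \<in> dom C" for v
    using that by (simp add: G_def app_lmult)
  have C_f: "\<exists>s::real. (s = 1 \<or> s = -1) \<and> C (f n) = Some (of_real s *\<^sub>C f n)" for n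
  proof -
    obtain s :: real where "s = 1 \<or> s = -1"
      "C_zero (L_plus J f) (L_minus J f) (f n) = Some (of_real s *\<^sub>C f n)"
      using assms(4) by (auto simp: quasi_basis_def quasi_maximal_def intro: C_zero_J_orthonormal[OF J])
    moreover from this have "C (f n) = Some (of_real s *\<^sub>C f n)"
      using assms(9) by (metis domI map_le_def)
    ultimately show ?thesis
      by blast
  qed
  have f_dom: "f n \<in> dom C" for n
    using C_f[of n] by auto
  obtain E where E: "spectral_measure E" "\<And>\<phi>. fun_calc \<phi> Q = spectral_integral E \<phi>"
  proof -
    \<comment> \<open>Without a spectral resolution the domain of \<open>C\<close> would be empty, but it contains \<open>f 0\<close>.\<close>
    have "\<exists>E. spectral_resolution E Q"
      using f_dom[of 0] assms(8) by (auto simp: lmult_def fun_calc_def split: if_splits)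
    then have "spectral_resolution (SOME E. spectral_resolution E Q) Q"
      by (rule someI_ex)
    then show ?thesis
      using that[of "SOME E. spectral_resolution E Q"] \<open>\<exists>E. spectral_resolution E Q\<close>
      by (auto simp: spectral_resolution_def fun_calc_def)
  qed
  interpret spectral_family E
    by unfold_locales (rule E)
  have quarter: "exp (t / 2) = (exp (t / 4))\<^sup>2" "exp t = ((exp (t / 4))\<^sup>2)\<^sup>2" for t :: real
    by (simp_all add: exp_double[symmetric])
  have R: "R = spectral_integral E (\<lambda>t. (exp (t / 4))\<^sup>2)"
    unfolding R_def E(2) quarter(1) ..
  have G: "G = spectral_integral E (\<lambda>t. ((exp (t / 4))\<^sup>2)\<^sup>2)"
    unfolding G_def assms(8) lmult_involution[OF J] E(2) quarter(2)[symmetric] ..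
  note square_root = spectral_integral_square_root[of "\<lambda>t. exp (t / 4)", folded R G]

  fix g
  assume g: "g \<in> dom C"
  show "Sums (H_G G) (\<lambda>n. Scale (H_G G) (indef J g (f n)) (H_G_embed G (f n))) (H_G_embed G (C \<cdot> g))"
  proof -
    \<comment> \<open>\<open>G C = J C\<^sup>2 = J\<close> on the domain of \<open>C\<close>, so the coefficients are the Fourier
        coefficients of \<open>C g\<close>.\<close>
    have "G_form G (C \<cdot> g) (f n) = indef J g (f n)" for n
      using involution[OF g] by (simp add: G_form_def G_app indef_def)
    then show ?thesis
      using form.Sums_Fourier_embed[of "C \<cdot> g" f] assms(10) involution[OF g] f_dom
      by (simp add: dom_G H_G_def H_G_embed_def)
  qed

  show "(\<lambda>n. indef J (R \<cdot> g) (f n) *\<^sub>C (R \<cdot> f n)) sums (C \<cdot> g)"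
  proof -
    have "cinner (C \<cdot> g) (R \<cdot> f n) = indef J (R \<cdot> g) (f n)" for n
    proof -
      obtain s :: real where s: "s = 1 \<or> s = -1" "C \<cdot> f n = of_real s *\<^sub>C f n"
        using C_f[of n] by (metis app_def option.sel)
      obtain r :: real where r: "r = 1 \<or> r = -1" "J (R \<cdot> f n) = of_real r *\<^sub>C (R \<cdot> f n)"
      proof (cases "R \<cdot> f n \<in> H_plus J")
        case True
        then show ?thesis
          using that[of 1] by (simp add: H_plus_eigenvector[OF J] scaleC_one)
      next
        case False
        then have "R \<cdot> f n \<in> H_minus J"
          using assms(12) by blast
        then show ?thesis
          using that[of "-1"]
          by (simp add: H_minus_eigenvector[OF J] scaleC_one complex_vector.scale_minus_left)
      qed
      have Gf: "G \<cdot> f n = of_real s *\<^sub>C J (f n)"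
        using s by (simp add: G_app f_dom fundamental_symmetry_scaleC[OF J])
      \<comment> \<open>\<open>r\<close> and \<open>s\<close> are the signs of \<open>[R f, R f]\<close> and \<open>[f, f]\<close>. They agree because \<open>(G f, R f) = r s (R f, f)\<close>,
        while Cauchy-Schwarz for the form of \<open>R\<close> bounds \<open>(R f, f) (G f, R f)\<close> below by \<open>\<parallel>R f\<parallel>\<^sup>4 = 1\<close>.\<close>
      have "r * s = 1"
      proof -
        have "cinner (G \<cdot> f n) (R \<cdot> f n) = of_real s * cinner (f n) (J (R \<cdot> f n))"
          by (simp add: Gf cinner_scaleC_left fundamental_symmetry_cinner[OF J])
        also have "\<dots> = of_real (r * s) * cinner (R \<cdot> f n) (f n)"
          using square_root(3)[of "f n"] f_dom[of n]
          by (simp add: r cinner_scaleC_right dom_G mult.left_commute)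
        finally have "Re (cinner (G \<cdot> f n) (R \<cdot> f n)) = (r * s) * Re (cinner (R \<cdot> f n) (f n))"
          by (simp add: Re_complex_of_real)
        moreover have "norm (R \<cdot> f n) = 1"
          using assms(11) by (simp add: orthonormal_basis_def norm_eq_sqrt_cinner)
        ultimately have "1 \<le> (r * s) * (Re (cinner (R \<cdot> f n) (f n)))\<^sup>2"
          using square_root(2)[of "f n"] f_dom[of n] by (simp add: dom_G power2_eq_square mult_ac)
        then have "r * s \<noteq> -1"
          using zero_le_power2[of "Re (cinner (R \<cdot> f n) (f n))"] 
          by (metis mult_minus1 neg_le_0_iff_le not_one_le_zero order_trans)
        then show ?thesis
          using r(1) s(1) by auto
      qed
      have "C \<cdot> g = J (G \<cdot> g)"
        by (simp add: G_app g fundamental_symmetry_involution[OF J])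
      then have "cinner (C \<cdot> g) (R \<cdot> f n) = of_real r * cinner (G \<cdot> g) (R \<cdot> f n)"
        by (simp add: fundamental_symmetry_cinner[OF J] r cinner_scaleC_right)
      also have "\<dots> = of_real r * cinner (R \<cdot> g) (G \<cdot> f n)"
        using square_root(1)[of g "f n"] g f_dom by (simp add: dom_G)
      also have "\<dots> = of_real (r * s) * indef J (R \<cdot> g) (f n)"
        by (simp add: Gf cinner_scaleC_right indef_def fundamental_symmetry_cinner[OF J])
      finally show ?thesis
        using \<open>r * s = 1\<close> by simp
    qed
    then show ?thesis
      using orthonormal_basis_sums[OF assms(11), of "C \<cdot> g"] by simp
  qed
qed

end
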